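(* Let $X\subset S$ be arbitrary sets, $H$ a bialgebra over $\Bbbk$ with $\Bbbk$-basis $G$ such that $1_H\in G$, let $\Bbbk\langle X\rangle$ be an $H$-module algebra, and let $f_s\in\Bbbk\langle X\rangle$ for all $s\in S$. Let $I_S$, $I_G$ be the ideals of $\Bbbk\langle S,G\rangle$ defined in the context. Then $$\Bbbk\langle X\rangle\#H\;\cong\;\Bbbk\langle S,G\rangle/(I_S+I_G),$$ and for any ideal $I$ of $\Bbbk\langle X\rangle\#H$ also $I_S+I_G+I$ is an ideal of $\Bbbk\langle S,G\rangle$ such that $$(\Bbbk\langle X\rangle\#H)/I\;\cong\;\Bbbk\langle S,G\rangle/(I_S+I_G+I).$$ Further we have the following special cases. If $H\cong\Bbbk$: $\ \Bbbk\langle X\rangle\cong\Bbbk\langle S\rangle/I_S$ and $\Bbbk\langle X\rangle/I\cong\Bbbk\langle S\rangle/(I_S+I)$ (where here $I_S$ is the ideal of $\Bbbk\langle S\rangle$ generated by the elements $s-f_s$, $s\in S$, and $I$ is an ideal of $\Bbbk\langle X\rangle$). If $S=X$: $\ \Bbbk\langle X\rangle\#H\cong\Bbbk\langle X,G\rangle/I_G$ and $(\Bbbk\langle X\rangle\#H)/I\cong\Bbbk\langle X,G\rangle/(I_G+I)$.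
   Context: $\Bbbk$ is a field, and $\cong$ denotes isomorphism of algebras. $\Bbbk\langle Y\rangle$ denotes the free $\Bbbk$-algebra on a set $Y$ and $\langle Y\rangle$ the free monoid. $\Bbbk\langle X\rangle\#H$ is the smash product. The elements of $G$ are also viewed as variables, and $\langle S,G\rangle$ is the free monoid on the union of $S$ and $G$, which may be assumed disjoint. Via the basis $G$, $H=\operatorname{span}_\Bbbk G\subset\Bbbk\langle G\rangle$ as a vector space, and omitting $\otimes$, the underlying space $\Bbbk\langle X\rangle\otimes H$ of the smash product is identified with the subspace $\operatorname{span}_\Bbbk\{ug: u\in\langle X\rangle,g\in G\}\subset\Bbbk\langle S,G\rangle$; in this way an ideal $I$ of $\Bbbk\langle X\rangle\#H$ is regarded as a subspace of $\Bbbk\langle S,G\rangle$. For $g,h\in G$ let $f_{gh}:=gh\in H=\operatorname{span}_\Bbbk G$ be the product in $H$, viewed as a linear combination of the variables in $G$. With Sweedler notation $\Delta(g)=g_{(1)}\otimes g_{(2)}$, the ideals are $$I_S:=(s-f_s\mid s\in S)_{\Bbbk\langle S,G\rangle},$$ $$I_G:=\bigl(gs-(g_{(1)}\cdot f_s)g_{(2)},\ gh-f_{gh},\ 1_H-1\mid g,h\in G,\ s\in S\bigr)_{\Bbbk\langle S,G\rangle},$$ where $(B)_A$ is the ideal of $A$ generated by the set $B$, $1$ is the empty word in $\Bbbk\langle S,G\rangle$, and $gs$, $gh$ (as first terms of the generators) are words in $\langle S,G\rangle$.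
   Formalization: The formal statement adds the assumption f_x = x for all x in X; without it the claim is false (for H = k, S = X = {x}, f_x = 0 the quotient is k, while the smash product is k[x]). *)

theory Defs
  imports Complex_Main "HOL-Library.Poly_Mapping" "HOL-Algebra.QuotRing" "HOL-Algebra.Module"
begin

section \<open>Formal linear combinations\<close>

text \<open>\<^typ>\<open>'a \<Rightarrow>\<^sub>0 'k\<close> serves as the vector space with basis \<^typ>\<open>'a\<close>;
  \<open>lin_ext\<close> is the linear extension of a map defined on that basis.\<close>

definition psmult :: "'k::field \<Rightarrow> ('a \<Rightarrow>\<^sub>0 'k) \<Rightarrow> ('a \<Rightarrow>\<^sub>0 'k)" where
  "psmult c p = Poly_Mapping.map ((*) c) p"

definition lin_ext :: "('k \<Rightarrow> 'b \<Rightarrow> 'b::ab_group_add) \<Rightarrow> ('a \<Rightarrow> 'b) \<Rightarrow> ('a \<Rightarrow>\<^sub>0 'k::field) \<Rightarrow> 'b" where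
  "lin_ext sc \<phi> p = (\<Sum>x\<in>Poly_Mapping.keys p. sc (Poly_Mapping.lookup p x) (\<phi> x))"


section \<open>Algebras as records, quotients and isomorphisms\<close>

text \<open>A \<open>k\<close>-algebra is given by a record of type \<open>('k, 'a) module\<close>, i.e. a ring record together
  with a scalar multiplication.  (The locale \<open>algebra\<close> of HOL-Algebra is for commutative
  algebras only.)\<close>

definition alg_iso :: "('k, 'a) module \<Rightarrow> ('k, 'b) module \<Rightarrow> bool" where
  "alg_iso A B \<longleftrightarrow>
     (\<exists>\<phi> \<in> ring_iso A B. \<forall>c. \<forall>x \<in> carrier A. \<phi> (c \<odot>\<^bsub>A\<^esub> x) = c \<odot>\<^bsub>B\<^esub> \<phi> x)"

text \<open>The ring \<open>A Quot I\<close> with the scalar multiplication \<open>c (x + I) = c x + I\<close>, in the same style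
  as \<^const>\<open>rcoset_mult\<close>.\<close>

definition alg_quot :: "('k, 'a) module \<Rightarrow> 'a set \<Rightarrow> ('k, 'a set) module" where
  "alg_quot A I =
     \<lparr>carrier = carrier (A Quot I), mult = mult (A Quot I), one = one (A Quot I),
      zero = zero (A Quot I), add = add (A Quot I),
      smult = (\<lambda>c C. \<Union>x\<in>C. I +>\<^bsub>A\<^esub> (c \<odot>\<^bsub>A\<^esub> x))\<rparr>"

definition type_alg :: "('k \<Rightarrow> 'a \<Rightarrow> 'a::ring_1) \<Rightarrow> ('k, 'a) module" where
  "type_alg sc = \<lparr>carrier = UNIV, mult = (*), one = 1, zero = 0, add = (+), smult = sc\<rparr>"


section \<open>Free algebras\<close>

text \<open>Words form a monoid under concatenation, written additively so that the convolution
  product on \<^typ>\<open>'v list \<Rightarrow>\<^sub>0 'k\<close> is the product of noncommutative polynomials.\<close>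

instantiation list :: (type) monoid_add
begin
definition zero_list :: "'a list" where "zero_list = []"
definition plus_list :: "'a list \<Rightarrow> 'a list \<Rightarrow> 'a list" where "plus_list = (@)"
instance by standard (simp_all add: zero_list_def plus_list_def)
end

definition free_carrier :: "'v set \<Rightarrow> ('v list \<Rightarrow>\<^sub>0 'k::field) set" where
  "free_carrier Y = {p. Poly_Mapping.keys p \<subseteq> lists Y}"

definition free_alg :: "'v set \<Rightarrow> ('k::field, 'v list \<Rightarrow>\<^sub>0 'k) module" where
  "free_alg Y = \<lparr>carrier = free_carrier Y, mult = (*), one = 1, zero = 0, add = (+), smult = psmult\<rparr>"

definition var :: "'v \<Rightarrow> ('v list \<Rightarrow>\<^sub>0 'k::field)" where
  "var y = Poly_Mapping.single [y] 1"


section \<open>Bialgebras and module algebras\<close>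

text \<open>For vector spaces \<open>V\<close>, \<open>W\<close> (with the given scalar multiplications) the tensor product is
  the space of formal linear combinations of pairs modulo the bilinearity relations
  \<open>tensor_null\<close>.  An element of a tensor product is given by a representative, and equality
  in the tensor product is \<open>tensor_eq\<close> (\<open>tensor3_eq\<close> for a triple tensor power).\<close>

definition tensor_null ::
  "('k::field \<Rightarrow> 'v \<Rightarrow> 'v::ab_group_add) \<Rightarrow> ('k \<Rightarrow> 'w \<Rightarrow> 'w::ab_group_add) \<Rightarrow> ('v \<times> 'w \<Rightarrow>\<^sub>0 'k) set" where
  "tensor_null sV sW = Modules.module.span psmult
     ({Poly_Mapping.single (a + a', b) 1 - Poly_Mapping.single (a, b) 1
         - Poly_Mapping.single (a', b) 1 | a a' b. True} \<union>
      {Poly_Mapping.single (a, b + b') 1 - Poly_Mapping.single (a, b) 1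
         - Poly_Mapping.single (a, b') 1 | a b b'. True} \<union>
      {Poly_Mapping.single (sV c a, b) 1 - Poly_Mapping.single (a, b) c | c a b. True} \<union>
      {Poly_Mapping.single (a, sW c b) 1 - Poly_Mapping.single (a, b) c | c a b. True})"

definition tensor_eq ::
  "('k::field \<Rightarrow> 'v \<Rightarrow> 'v::ab_group_add) \<Rightarrow> ('v \<times> 'v \<Rightarrow>\<^sub>0 'k) \<Rightarrow> ('v \<times> 'v \<Rightarrow>\<^sub>0 'k) \<Rightarrow> bool" where
  "tensor_eq sV p q \<longleftrightarrow> p - q \<in> tensor_null sV sV"

definition tensor3_null ::
  "('k::field \<Rightarrow> 'v \<Rightarrow> 'v::ab_group_add) \<Rightarrow> ('v \<times> 'v \<times> 'v \<Rightarrow>\<^sub>0 'k) set" where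
  "tensor3_null sV = Modules.module.span psmult
     ({Poly_Mapping.single (a + a', b, d) 1 - Poly_Mapping.single (a, b, d) 1
         - Poly_Mapping.single (a', b, d) 1 | a a' b d. True} \<union>
      {Poly_Mapping.single (a, b + b', d) 1 - Poly_Mapping.single (a, b, d) 1
         - Poly_Mapping.single (a, b', d) 1 | a b b' d. True} \<union>
      {Poly_Mapping.single (a, b, d + d') 1 - Poly_Mapping.single (a, b, d) 1
         - Poly_Mapping.single (a, b, d') 1 | a b d d'. True} \<union>
      {Poly_Mapping.single (sV c a, b, d) 1 - Poly_Mapping.single (a, b, d) c | c a b d. True} \<union>
      {Poly_Mapping.single (a, sV c b, d) 1 - Poly_Mapping.single (a, b, d) c | c a b d. True} \<union>
      {Poly_Mapping.single (a, b, sV c d) 1 - Poly_Mapping.single (a, b, d) c | c a b d. True})"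

definition tensor3_eq ::
  "('k::field \<Rightarrow> 'v \<Rightarrow> 'v::ab_group_add) \<Rightarrow> ('v \<times> 'v \<times> 'v \<Rightarrow>\<^sub>0 'k) \<Rightarrow> ('v \<times> 'v \<times> 'v \<Rightarrow>\<^sub>0 'k) \<Rightarrow> bool" where
  "tensor3_eq sV p q \<longleftrightarrow> p - q \<in> tensor3_null sV"

definition tensor_mult ::
  "('a::times \<times> 'a \<Rightarrow>\<^sub>0 'k::field) \<Rightarrow> ('a \<times> 'a \<Rightarrow>\<^sub>0 'k) \<Rightarrow> ('a \<times> 'a \<Rightarrow>\<^sub>0 'k)" where
  "tensor_mult p q =
     lin_ext psmult (\<lambda>(a, b). lin_ext psmult (\<lambda>(c, d). Poly_Mapping.single (a * c, b * d) 1) q) p"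

locale k_algebra = vector_space scale
  for scale :: "'k::field \<Rightarrow> 'a::ring_1 \<Rightarrow> 'a" +
  assumes scale_mult_left: "scale c x * y = scale c (x * y)"
    and scale_mult_right: "x * scale c y = scale c (x * y)"

text \<open>\<open>\<Delta> h\<close> is a representative of the coproduct of \<open>h\<close> in \<open>H \<otimes> H\<close>; thus the Sweedler expression
  \<open>\<phi> h\<^sub>(\<^sub>1\<^sub>) h\<^sub>(\<^sub>2\<^sub>)\<close>, for a bilinear \<open>\<phi>\<close>, is \<open>lin_ext _ (\<lambda>(a, b). \<phi> a b) (\<Delta> h)\<close>.\<close>

locale bialgebra = k_algebra scale
  for scale :: "'k::field \<Rightarrow> 'h::ring_1 \<Rightarrow> 'h" +
  fixes \<Delta> :: "'h \<Rightarrow> ('h \<times> 'h \<Rightarrow>\<^sub>0 'k)"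
    and \<epsilon> :: "'h \<Rightarrow> 'k"
  assumes comult_add: "tensor_eq scale (\<Delta> (x + y)) (\<Delta> x + \<Delta> y)"
    and comult_scale: "tensor_eq scale (\<Delta> (scale c x)) (psmult c (\<Delta> x))"
    and counit_add: "\<epsilon> (x + y) = \<epsilon> x + \<epsilon> y"
    and counit_scale: "\<epsilon> (scale c x) = c * \<epsilon> x"
    and coassoc: "tensor3_eq scale
      (lin_ext psmult (\<lambda>(a, b). lin_ext psmult (\<lambda>(c, d). Poly_Mapping.single (c, d, b) 1) (\<Delta> a)) (\<Delta> x))
      (lin_ext psmult (\<lambda>(a, b). lin_ext psmult (\<lambda>(c, d). Poly_Mapping.single (a, c, d) 1) (\<Delta> b)) (\<Delta> x))"
    and counit_left: "lin_ext scale (\<lambda>(a, b). scale (\<epsilon> a) b) (\<Delta> x) = x"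
    and counit_right: "lin_ext scale (\<lambda>(a, b). scale (\<epsilon> b) a) (\<Delta> x) = x"
    and comult_mult: "tensor_eq scale (\<Delta> (x * y)) (tensor_mult (\<Delta> x) (\<Delta> y))"
    and comult_one: "tensor_eq scale (\<Delta> 1) (Poly_Mapping.single (1, 1) 1)"
    and counit_mult: "\<epsilon> (x * y) = \<epsilon> x * \<epsilon> y"
    and counit_one: "\<epsilon> 1 = 1"

text \<open>\<open>A\<close> is a subalgebra of the ambient algebra \<^typ>\<open>'a\<close>; the action is only specified on \<open>A\<close>.\<close>

locale module_algebra = bialgebra scale \<Delta> \<epsilon> + A: k_algebra sA
  for scale :: "'k::field \<Rightarrow> 'h::ring_1 \<Rightarrow> 'h" and \<Delta> \<epsilon>
    and sA :: "'k \<Rightarrow> 'a::ring_1 \<Rightarrow> 'a" +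
  fixes A :: "'a set" and act :: "'h \<Rightarrow> 'a \<Rightarrow> 'a"
  assumes A_subspace: "A.subspace A"
    and A_one: "1 \<in> A"
    and A_mult: "a \<in> A \<Longrightarrow> b \<in> A \<Longrightarrow> a * b \<in> A"
    and act_closed: "a \<in> A \<Longrightarrow> act h a \<in> A"
    and act_add_left: "a \<in> A \<Longrightarrow> act (g + h) a = act g a + act h a"
    and act_scale_left: "a \<in> A \<Longrightarrow> act (scale c h) a = sA c (act h a)"
    and act_add_right: "a \<in> A \<Longrightarrow> b \<in> A \<Longrightarrow> act h (a + b) = act h a + act h b"
    and act_scale_right: "a \<in> A \<Longrightarrow> act h (sA c a) = sA c (act h a)"
    and act_one_left: "a \<in> A \<Longrightarrow> act 1 a = a"
    and act_mult_left: "a \<in> A \<Longrightarrow> act (g * h) a = act g (act h a)"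
    and act_mult_right: "a \<in> A \<Longrightarrow> b \<in> A \<Longrightarrow>
          act h (a * b) = lin_ext sA (\<lambda>(h1, h2). act h1 a * act h2 b) (\<Delta> h)"
    and act_one_right: "act h 1 = sA (\<epsilon> h) 1"

definition is_basis :: "('k::field \<Rightarrow> 'h::ab_group_add \<Rightarrow> 'h) \<Rightarrow> 'h set \<Rightarrow> bool" where
  "is_basis scale G \<longleftrightarrow> \<not> Modules.module.dependent scale G \<and> Modules.module.span scale G = UNIV"


section \<open>The smash product\<close>

text \<open>\<open>coords scale G h\<close> is \<open>h\<close> written as a formal linear combination of elements of the basis
  \<open>G\<close>.  The space \<open>k<X> \<otimes> H\<close> has the basis consisting of all \<open>u \<otimes> g\<close> with \<open>u\<close> a word over
  \<open>X\<close> and \<open>g \<in> G\<close>; it is realised as formal linear combinations of such pairs \<open>(u, g)\<close>, and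
  \<open>tens scale G p h\<close> is the element \<open>p \<otimes> h\<close>.\<close>

definition coords :: "('k::field \<Rightarrow> 'h::ab_group_add \<Rightarrow> 'h) \<Rightarrow> 'h set \<Rightarrow> 'h \<Rightarrow> ('h \<Rightarrow>\<^sub>0 'k)" where
  "coords scale G h = (\<Sum>g | Modules.module.representation scale G h g \<noteq> 0.
     Poly_Mapping.single g (Modules.module.representation scale G h g))"

definition tens :: "('k::field \<Rightarrow> 'h::ab_group_add \<Rightarrow> 'h) \<Rightarrow> 'h set \<Rightarrow>
    ('s list \<Rightarrow>\<^sub>0 'k) \<Rightarrow> 'h \<Rightarrow> ('s list \<times> 'h \<Rightarrow>\<^sub>0 'k)" where
  "tens scale G p h =
     lin_ext psmult (\<lambda>u. lin_ext psmult (\<lambda>g. Poly_Mapping.single (u, g) 1) (coords scale G h)) p"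

text \<open>The product is the bilinear extension of
  \<open>(u # g) (v # h) = u (g\<^sub>(\<^sub>1\<^sub>) \<cdot> v) # g\<^sub>(\<^sub>2\<^sub>) h\<close>.\<close>

definition smash_mult :: "('k::field \<Rightarrow> 'h::ring_1 \<Rightarrow> 'h) \<Rightarrow> ('h \<Rightarrow> ('h \<times> 'h \<Rightarrow>\<^sub>0 'k)) \<Rightarrow>
    ('h \<Rightarrow> ('s list \<Rightarrow>\<^sub>0 'k) \<Rightarrow> ('s list \<Rightarrow>\<^sub>0 'k)) \<Rightarrow> 'h set \<Rightarrow>
    ('s list \<times> 'h \<Rightarrow>\<^sub>0 'k) \<Rightarrow> ('s list \<times> 'h \<Rightarrow>\<^sub>0 'k) \<Rightarrow> ('s list \<times> 'h \<Rightarrow>\<^sub>0 'k)" where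
  "smash_mult scale \<Delta> act G p q =
     lin_ext psmult (\<lambda>(u, g). lin_ext psmult (\<lambda>(v, h).
       lin_ext psmult (\<lambda>(g1, g2).
         tens scale G (Poly_Mapping.single u 1 * act g1 (Poly_Mapping.single v 1)) (g2 * h)) (\<Delta> g)) q) p"

definition smash :: "('k::field \<Rightarrow> 'h::ring_1 \<Rightarrow> 'h) \<Rightarrow> ('h \<Rightarrow> ('h \<times> 'h \<Rightarrow>\<^sub>0 'k)) \<Rightarrow>
    ('h \<Rightarrow> ('s list \<Rightarrow>\<^sub>0 'k) \<Rightarrow> ('s list \<Rightarrow>\<^sub>0 'k)) \<Rightarrow> 'h set \<Rightarrow> 's set \<Rightarrow>
    ('k, 's list \<times> 'h \<Rightarrow>\<^sub>0 'k) module" where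
  "smash scale \<Delta> act G X =
     \<lparr>carrier = {p. Poly_Mapping.keys p \<subseteq> lists X \<times> G},
      mult = smash_mult scale \<Delta> act G, one = tens scale G 1 1, zero = 0, add = (+), smult = psmult\<rparr>"


section \<open>The algebra on \<open>S\<close> and \<open>G\<close>, and its ideals\<close>

text \<open>The disjoint union of \<open>S\<close> and \<open>G\<close> is formed in the sum type.  \<open>emb\<close> is the inclusion of
  the free algebra on \<open>S\<close>, \<open>hvar h\<close> is \<open>h \<in> H = span G\<close> as a linear combination of the variables
  in \<open>G\<close>, and \<open>incl\<close> is the identification of \<open>k<X> \<otimes> H\<close> with the span of the words \<open>u g\<close>.\<close>

definition free_SG :: "'s set \<Rightarrow> 'h set \<Rightarrow> ('k::field, ('s + 'h) list \<Rightarrow>\<^sub>0 'k) module" where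
  "free_SG S G = free_alg (Inl ` S \<union> Inr ` G)"

definition emb :: "('s list \<Rightarrow>\<^sub>0 'k::field) \<Rightarrow> (('s + 'h) list \<Rightarrow>\<^sub>0 'k)" where
  "emb = lin_ext psmult (\<lambda>u. Poly_Mapping.single (map Inl u) 1)"

definition hvar :: "('k::field \<Rightarrow> 'h::ab_group_add \<Rightarrow> 'h) \<Rightarrow> 'h set \<Rightarrow> 'h \<Rightarrow> (('s + 'h) list \<Rightarrow>\<^sub>0 'k)" where
  "hvar scale G h = lin_ext psmult (\<lambda>g. var (Inr g)) (coords scale G h)"

definition incl :: "('s list \<times> 'h \<Rightarrow>\<^sub>0 'k::field) \<Rightarrow> (('s + 'h) list \<Rightarrow>\<^sub>0 'k)" where
  "incl = lin_ext psmult (\<lambda>(u, g). Poly_Mapping.single (map Inl u @ [Inr g]) 1)"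

definition I_S :: "'s set \<Rightarrow> 'h set \<Rightarrow> ('s \<Rightarrow> ('s list \<Rightarrow>\<^sub>0 'k::field)) \<Rightarrow> (('s + 'h) list \<Rightarrow>\<^sub>0 'k) set" where
  "I_S S G f = Idl\<^bsub>free_SG S G\<^esub> {var (Inl s) - emb (f s) | s. s \<in> S}"

definition I_G :: "('k::field \<Rightarrow> 'h::ring_1 \<Rightarrow> 'h) \<Rightarrow> ('h \<Rightarrow> ('h \<times> 'h \<Rightarrow>\<^sub>0 'k)) \<Rightarrow>
    ('h \<Rightarrow> ('s list \<Rightarrow>\<^sub>0 'k) \<Rightarrow> ('s list \<Rightarrow>\<^sub>0 'k)) \<Rightarrow> 's set \<Rightarrow> 'h set \<Rightarrow>
    ('s \<Rightarrow> ('s list \<Rightarrow>\<^sub>0 'k)) \<Rightarrow> (('s + 'h) list \<Rightarrow>\<^sub>0 'k) set" where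
  "I_G scale \<Delta> act S G f = Idl\<^bsub>free_SG S G\<^esub>
     ({var (Inr g) * var (Inl s)
         - lin_ext psmult (\<lambda>(g1, g2). emb (act g1 (f s)) * hvar scale G g2) (\<Delta> g) | g s. g \<in> G \<and> s \<in> S} \<union>
      {var (Inr g) * var (Inr h) - hvar scale G (g * h) | g h. g \<in> G \<and> h \<in> G} \<union>
      {var (Inr 1) - 1})"

definition I_S_plain :: "'s set \<Rightarrow> ('s \<Rightarrow> ('s list \<Rightarrow>\<^sub>0 'k::field)) \<Rightarrow> ('s list \<Rightarrow>\<^sub>0 'k) set" where
  "I_S_plain S f = Idl\<^bsub>free_alg S\<^esub> {var s - f s | s. s \<in> S}"

end

(* Let F be the free algebra on S and G.  Modulo I_S + I_G every word of F can be rewritten into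
   the span of the words u g, and there the relations reproduce the product of the smash product;
   here coassociativity is used to move g past a word u one letter at a time.  No further
   collapsing occurs, because F acts on k<X> # H: a letter s multiplies by f_s, and a letter g
   acts as (1 # g).  This action kills I_S + I_G, while the element u g sends 1 # 1 to u # g.
   The action is built letter by letter, so that associativity of the smash product is never
   needed; it is only inherited through the isomorphism.  The statements about an ideal I
   follow formally from such a normal form, and H = k is treated as the analogous presentation
   of k<X> by S, with the homomorphism s |-> f_s in place of the action. *)

theory Submission
  imports Defs
begin

section \<open>Linear extension\<close>

text \<open>The obstacle is well-definedness. The coproduct is only a representative in a tensor
  product, so linearity, multiplicativity and coassociativity of \<Delta> hold only modulo the
  bilinearity relations. A Sweedler expression may therefore be rearranged only once its summand is
  known to be bilinear or trilinear. The legs of \<Delta> g need not lie in G, so every relation,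
  given for basis elements only, is extended to all of H before it is applied to the second leg. The
  action is specified only on k<X>, so its identities are proved on pure tensors p # h with p in
  k<X>, and the ideal is shown to annihilate the span of these rather than all formal combinations.
  That f x = x for x in X matters twice: it lets the relation for g s move g past a letter of a word
  over X, and it makes the copy of k<X> inside F act by left multiplication.\<close>

lemma lookup_psmult [simp]: "Poly_Mapping.lookup (psmult c p) x = c * Poly_Mapping.lookup p x"
  by (simp add: psmult_def Poly_Mapping.map.rep_eq when_def)

lemma psmult_single [simp]: "psmult c (Poly_Mapping.single x d) = Poly_Mapping.single x (c * d)"
  by (rule poly_mapping_eqI) (simp add: lookup_single when_def)

interpretation pm: vector_space "psmult :: 'k::field \<Rightarrow> ('a \<Rightarrow>\<^sub>0 'k) \<Rightarrow> _"
  by unfold_locales (auto intro!: poly_mapping_eqI simp: lookup_add algebra_simps)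

context vector_space
begin

text \<open>The supports of p, q and p + q differ because of cancellation. Summing over a common
  finite superset makes the sums comparable.\<close>

lemma lin_ext_superset:
  assumes "finite K" "Poly_Mapping.keys p \<subseteq> K"
  shows "lin_ext scale \<phi> p = (\<Sum>x\<in>K. scale (Poly_Mapping.lookup p x) (\<phi> x))"
  unfolding lin_ext_def
  by (rule sum.mono_neutral_left) (use assms in \<open>auto simp: in_keys_iff\<close>)

lemma lin_ext_add: "lin_ext scale \<phi> (p + q) = lin_ext scale \<phi> p + lin_ext scale \<phi> q"
proof -
  let ?K = "Poly_Mapping.keys p \<union> Poly_Mapping.keys q"
  have K: "Poly_Mapping.keys (p + q) \<subseteq> ?K" by (rule Poly_Mapping.keys_add)
  show ?thesis
    using lin_ext_superset[OF _ K, of \<phi>] lin_ext_superset[of ?K p \<phi>] lin_ext_superset[of ?K q \<phi>]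
    by (simp add: lookup_add scale_left_distrib sum.distrib)
qed

lemma lin_ext_psmult: "lin_ext scale \<phi> (psmult c p) = scale c (lin_ext scale \<phi> p)"
proof -
  have K: "Poly_Mapping.keys (psmult c p) \<subseteq> Poly_Mapping.keys p"
    by (auto simp: in_keys_iff)
  show ?thesis
    unfolding lin_ext_superset[OF finite_keys K] by (simp add: lin_ext_def scale_sum_right)
qed

lemma linear_lin_ext: "Vector_Spaces.linear psmult scale (lin_ext scale \<phi>)"
  by (intro Vector_Spaces.linear.intro module_hom.intro module_hom_axioms.intro
      pm.module_axioms pm.vector_space_axioms vector_space_axioms module_axioms
      lin_ext_add lin_ext_psmult)

lemma lin_ext_zero [simp]: "lin_ext scale \<phi> 0 = 0"
  by (simp add: lin_ext_def)

lemma lin_ext_diff: "lin_ext scale \<phi> (p - q) = lin_ext scale \<phi> p - lin_ext scale \<phi> q"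
  using lin_ext_add[of \<phi> "p - q" q] by (simp add: algebra_simps)

lemma lin_ext_single [simp]: "lin_ext scale \<phi> (Poly_Mapping.single x c) = scale c (\<phi> x)"
  by (subst lin_ext_superset[where K = "{x}"]) auto

lemma lin_ext_fun_add:
  "lin_ext scale (\<lambda>x. \<phi> x + \<psi> x) p = lin_ext scale \<phi> p + lin_ext scale \<psi> p"
  by (simp add: lin_ext_def scale_right_distrib sum.distrib)

lemma lin_ext_fun_diff:
  "lin_ext scale (\<lambda>x. \<phi> x - \<psi> x) p = lin_ext scale \<phi> p - lin_ext scale \<psi> p"
  by (simp add: lin_ext_def scale_right_diff_distrib sum_subtractf)

lemma lin_ext_fun_scale: "lin_ext scale (\<lambda>x. scale c (\<phi> x)) p = scale c (lin_ext scale \<phi> p)"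
  by (simp add: lin_ext_def scale_sum_right mult.commute)

lemma lin_ext_in_subspace:
  assumes "subspace W" "\<And>x. x \<in> Poly_Mapping.keys p \<Longrightarrow> \<phi> x \<in> W"
  shows "lin_ext scale \<phi> p \<in> W"
  unfolding lin_ext_def by (intro subspace_sum subspace_scale assms)

end

lemma lin_ext_cong:
  "(\<And>x. x \<in> Poly_Mapping.keys p \<Longrightarrow> \<phi> x = \<psi> x) \<Longrightarrow> lin_ext sc \<phi> p = lin_ext sc \<psi> p"
  by (simp add: lin_ext_def)

lemma linear_lin_ext_apply:
  assumes "Vector_Spaces.linear s1 s2 T"
  shows "T (lin_ext s1 \<phi> p) = lin_ext s2 (\<lambda>x. T (\<phi> x)) p"
proof -
  interpret Vector_Spaces.linear s1 s2 T by fact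
  show ?thesis by (simp add: lin_ext_def sum scale)
qed

text \<open>Read from right to left, this expands an element into basis vectors, so that identities
  between linear maps need checking on the basis only.\<close>

lemma lin_ext_basis [simp]: "lin_ext psmult (\<lambda>x. Poly_Mapping.single x 1) p = p"
  by (rule poly_mapping_eqI)
    (auto simp: lin_ext_def lookup_sum lookup_single when_def sum.delta' in_keys_iff)

lemma linear_eq_lin_ext:
  assumes "Vector_Spaces.linear psmult s2 T"
  shows "T p = lin_ext s2 (\<lambda>x. T (Poly_Mapping.single x 1)) p"
  using linear_lin_ext_apply[OF assms, of "\<lambda>x. Poly_Mapping.single x 1" p] by simp

lemma (in vector_space) lin_ext_lin_ext:
  "lin_ext scale \<psi> (lin_ext psmult \<phi> p) = lin_ext scale (\<lambda>x. lin_ext scale \<psi> (\<phi> x)) p"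
  by (rule linear_lin_ext_apply[OF linear_lin_ext])

lemma linear_psmultI:
  assumes "\<And>p q. T (p + q) = T p + T q" "\<And>c p. T (psmult c p) = psmult c (T p)"
  shows "Vector_Spaces.linear psmult psmult T"
  by (intro Vector_Spaces.linear.intro module_hom.intro module_hom_axioms.intro
      pm.module_axioms pm.vector_space_axioms assms)

lemma linear_subspace_vimage:
  assumes "Vector_Spaces.linear s1 s2 T" "Modules.module.subspace s2 W"
  shows "Modules.module.subspace s1 {x. T x \<in> W}"
proof -
  interpret Vector_Spaces.linear s1 s2 T by fact
  show ?thesis
    using assms(2) by (simp add: vs1.subspace_def vs2.subspace_def add scale)
qed


section \<open>The algebra of words\<close>

lemma psmult_eq_single_mult: "psmult c p = Poly_Mapping.single 0 c * p"
  unfolding psmult_def by (rule mult_map_scale_conv_mult)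

text \<open>Constants are central although words do not commute: after expansion into monomials,
  \<open>0\<close> is neutral on both sides and the coefficients commute in the field.\<close>

lemma mult_single_zero_commute:
  fixes p :: "'a::monoid_add \<Rightarrow>\<^sub>0 'k::field"
  shows "p * Poly_Mapping.single 0 c = Poly_Mapping.single 0 c * p"
proof -
  have p: "p = (\<Sum>x\<in>Poly_Mapping.keys p. Poly_Mapping.single x (Poly_Mapping.lookup p x))"
    using lin_ext_basis[of p] by (simp add: lin_ext_def)
  show ?thesis
    by (subst (1 2) p) (simp add: sum_distrib_left sum_distrib_right mult_single mult.commute)
qed

lemma psmult_mult_left [simp]:
  fixes p :: "'a::monoid_add \<Rightarrow>\<^sub>0 'k::field"
  shows "psmult c p * q = psmult c (p * q)"
  by (simp add: psmult_eq_single_mult mult.assoc)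

lemma psmult_mult_right [simp]:
  fixes p :: "'a::monoid_add \<Rightarrow>\<^sub>0 'k::field"
  shows "p * psmult c q = psmult c (p * q)"
  by (metis psmult_eq_single_mult mult.assoc mult_single_zero_commute)

lemma linear_mult_left:
  fixes a :: "'a::monoid_add \<Rightarrow>\<^sub>0 'k::field"
  shows "Vector_Spaces.linear psmult psmult ((*) a)"
  by (rule linear_psmultI) (simp_all add: distrib_left)

lemma linear_mult_right:
  fixes a :: "'a::monoid_add \<Rightarrow>\<^sub>0 'k::field"
  shows "Vector_Spaces.linear psmult psmult (\<lambda>p. p * a)"
  by (rule linear_psmultI) (simp_all add: distrib_right)

lemmas mult_lin_ext = linear_lin_ext_apply[OF linear_mult_left]
  and lin_ext_mult = linear_lin_ext_apply[OF linear_mult_right]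

lemma single_mult_single [simp]:
  "Poly_Mapping.single (u :: 'v list) (c :: 'k::field) * Poly_Mapping.single v d = Poly_Mapping.single (u @ v) (c * d)"
  by (simp add: mult_single plus_list_def)

lemma single_Nil_1 [simp]: "Poly_Mapping.single ([] :: 'v list) (1 :: 'k::field) = 1"
  by (metis single_one zero_list_def)

lemma single_Cons:
  "Poly_Mapping.single (x # u) (1 :: 'k::field) = var x * Poly_Mapping.single u 1"
  by (simp add: var_def)

section \<open>Polynomials supported on words over a given alphabet\<close>

lemma free_carrier_subspace:
  "pm.subspace (free_carrier Y :: ('v list \<Rightarrow>\<^sub>0 'k::field) set)"
proof (rule pm.subspaceI)
  fix p q :: "'v list \<Rightarrow>\<^sub>0 'k" and c
  assume p: "p \<in> free_carrier Y"
  then show "psmult c p \<in> free_carrier Y"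
    unfolding free_carrier_def subset_iff mem_Collect_eq in_keys_iff by simp
  assume "q \<in> free_carrier Y"
  with p show "p + q \<in> free_carrier Y"
    using Poly_Mapping.keys_add[of p q] unfolding free_carrier_def by blast
qed (simp add: free_carrier_def)

lemmas free_carrier_closed [simp, intro] =
  pm.subspace_0[OF free_carrier_subspace] pm.subspace_add[OF free_carrier_subspace]
  pm.subspace_scale[OF free_carrier_subspace] pm.subspace_diff[OF free_carrier_subspace]
  pm.subspace_neg[OF free_carrier_subspace]

lemma free_carrier_mult [simp, intro]:
  assumes "p \<in> free_carrier Y" "q \<in> free_carrier Y"
  shows "p * q \<in> free_carrier Y"
proof -
  have "Poly_Mapping.keys (p * q)
      \<subseteq> {a + b |a b. a \<in> Poly_Mapping.keys p \<and> b \<in> Poly_Mapping.keys q}"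
    by (rule keys_mult)
  also have "\<dots> \<subseteq> lists Y"
    using assms by (fastforce simp: free_carrier_def plus_list_def)
  finally show ?thesis by (simp add: free_carrier_def)
qed

lemma single_in_free_carrier [simp, intro]:
  "u \<in> lists Y \<Longrightarrow> Poly_Mapping.single u c \<in> free_carrier Y"
  by (simp add: free_carrier_def)

lemma one_in_free_carrier [simp, intro]: "1 \<in> free_carrier Y"
  unfolding single_Nil_1[symmetric] by (rule single_in_free_carrier) simp

lemma var_in_free_carrier [simp, intro]: "y \<in> Y \<Longrightarrow> var y \<in> free_carrier Y"
  by (simp add: var_def)

lemma free_carrier_induct [consumes 1, case_names add scale word]:
  assumes p: "p \<in> free_carrier Y"
    and add: "\<And>p q. p \<in> free_carrier Y \<Longrightarrow> q \<in> free_carrier Y \<Longrightarrow> P p \<Longrightarrow> P q \<Longrightarrow> P (p + q)"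
    and scale: "\<And>c p. p \<in> free_carrier Y \<Longrightarrow> P p \<Longrightarrow> P (psmult c p)"
    and word: "\<And>u. u \<in> lists Y \<Longrightarrow> P (Poly_Mapping.single u 1)"
  shows "P p"
proof -
  \<comment> \<open>There is no separate zero case; zero is obtained by scaling the empty word by
    0.\<close>
  have "P (psmult 0 (Poly_Mapping.single [] 1))"
    by (intro scale word) auto
  then have "pm.subspace {p \<in> free_carrier Y. P p}"
    by (intro pm.subspaceI) (auto intro: add scale)
  then have "lin_ext psmult (\<lambda>x. Poly_Mapping.single x 1) p \<in> {p \<in> free_carrier Y. P p}"
    by (rule pm.lin_ext_in_subspace) (use p in \<open>auto simp: free_carrier_def intro!: word\<close>)
  then show ?thesis by simp
qed

lemma free_alg_simps [simp]:
  "carrier (free_alg Y) = free_carrier Y" "mult (free_alg Y) = (*)" "one (free_alg Y) = 1"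
  "zero (free_alg Y) = 0" "add (free_alg Y) = (+)" "smult (free_alg Y) = psmult"
  by (simp_all add: free_alg_def)

lemma ring_free_alg: "ring (free_alg Y)"
proof (rule ringI)
  show "abelian_group (free_alg Y)"
  proof (rule abelian_groupI)
    fix x assume "x \<in> carrier (free_alg Y)"
    then show "\<exists>y\<in>carrier (free_alg Y). y \<oplus>\<^bsub>free_alg Y\<^esub> x = \<zero>\<^bsub>free_alg Y\<^esub>"
      by (intro bexI[of _ "- x"]) simp_all
  qed (simp_all add: add_ac)
  show "Group.monoid (free_alg Y)"
    by (rule monoidI) (simp_all add: mult.assoc)
qed (simp_all add: algebra_simps)

lemma a_inv_free_alg [simp]: "x \<in> free_carrier Y \<Longrightarrow> \<ominus>\<^bsub>free_alg Y\<^esub> x = - x"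
proof -
  interpret ring "free_alg Y" by (rule ring_free_alg)
  show "x \<in> free_carrier Y \<Longrightarrow> ?thesis"
    using minus_equality[of "- x" x] by simp
qed

lemma ideal_free_algI:
  assumes "J \<subseteq> free_carrier Y" "pm.subspace J"
    and "\<And>a x. a \<in> J \<Longrightarrow> x \<in> free_carrier Y \<Longrightarrow> x * a \<in> J"
    and "\<And>a x. a \<in> J \<Longrightarrow> x \<in> free_carrier Y \<Longrightarrow> a * x \<in> J"
  shows "ideal J (free_alg Y)"
proof (rule idealI[OF ring_free_alg])
  interpret ring "free_alg Y" by (rule ring_free_alg)
  show "subgroup J (add_monoid (free_alg Y))"
  proof (rule add.subgroupI)
    show "J \<subseteq> carrier (free_alg Y)" using assms(1) by simp
  next
    show "J \<noteq> {}" using pm.subspace_0[OF assms(2)] by auto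
  next
    fix a assume "a \<in> J"
    then show "\<ominus>\<^bsub>free_alg Y\<^esub> a \<in> J"
      using assms(1) pm.subspace_neg[OF assms(2)] by auto
  next
    fix a b assume "a \<in> J" "b \<in> J"
    then show "a \<oplus>\<^bsub>free_alg Y\<^esub> b \<in> J"
      using pm.subspace_add[OF assms(2)] by simp
  qed
qed (use assms in auto)

text \<open>\<open>a - b \<in> J\<close> serves as congruence modulo J, so that rewriting in the
  quotient is done with representatives and cosets appear only at the end.\<close>

locale free_ideal =
  fixes J :: "('v list \<Rightarrow>\<^sub>0 'k::field) set" and Y
  assumes is_ideal: "ideal J (free_alg Y)"
begin

sublocale ideal J "free_alg Y" by (rule is_ideal)

lemma in_carrier: "x \<in> J \<Longrightarrow> x \<in> free_carrier Y"
  using a_subset by auto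

lemma mult_closed_left: "a \<in> free_carrier Y \<Longrightarrow> x \<in> J \<Longrightarrow> a * x \<in> J"
  using I_l_closed[of x a] by simp

lemma mult_closed_right: "a \<in> free_carrier Y \<Longrightarrow> x \<in> J \<Longrightarrow> x * a \<in> J"
  using I_r_closed[of x a] by simp

text \<open>An ideal here is a ring ideal. It absorbs scalars because scaling by c is multiplication
  by the constant polynomial c.\<close>

lemma is_subspace: "pm.subspace J"
proof (rule pm.subspaceI)
  show "0 \<in> J" using additive_subgroup.zero_closed[OF is_additive_subgroup] by simp
  show "x + y \<in> J" if "x \<in> J" "y \<in> J" for x y using additive_subgroup.a_closed[OF is_additive_subgroup that] by simp
  show "psmult c x \<in> J" if "x \<in> J" for c x
    using that mult_closed_left[of "Poly_Mapping.single 0 c" x]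
    by (simp add: psmult_eq_single_mult zero_list_def)
qed

lemmas J_zero = pm.subspace_0[OF is_subspace]
  and J_add = pm.subspace_add[OF is_subspace]
  and J_diff = pm.subspace_diff[OF is_subspace]
  and J_scale = pm.subspace_scale[OF is_subspace]

lemma J_trans: "a - b \<in> J \<Longrightarrow> b - c \<in> J \<Longrightarrow> a - c \<in> J"
  using J_add[of "a - b" "b - c"] by simp

lemma J_sym: "a - b \<in> J \<Longrightarrow> b - a \<in> J"
  using pm.subspace_neg[OF is_subspace, of "a - b"] by simp

text \<open>The splitting a(c - d) + (a - b)d shows why membership in the carrier is asked of a and
  d only.\<close>

lemma J_mult:
  assumes "a - b \<in> J" "c - d \<in> J" "a \<in> free_carrier Y" "d \<in> free_carrier Y"
  shows "a * c - b * d \<in> J"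
proof -
  have "a * (c - d) + (a - b) * d \<in> J"
    by (intro J_add mult_closed_left mult_closed_right assms)
  then show ?thesis by (simp add: algebra_simps)
qed

lemma J_lin_ext:
  assumes "\<And>x. x \<in> Poly_Mapping.keys p \<Longrightarrow> \<phi> x - \<psi> x \<in> J"
  shows "lin_ext psmult \<phi> p - lin_ext psmult \<psi> p \<in> J"
  using pm.lin_ext_in_subspace[OF is_subspace assms]
  by (simp add: pm.lin_ext_fun_diff)

lemma coset_eq_iff:
  assumes "x \<in> free_carrier Y" "y \<in> free_carrier Y"
  shows "J +>\<^bsub>free_alg Y\<^esub> x = J +>\<^bsub>free_alg Y\<^esub> y \<longleftrightarrow> x - y \<in> J"
  using quotient_eq_iff_same_a_r_cos[OF is_ideal, of x y] assms
  by (simp add: a_minus_def)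

end
section \<open>Presentations\<close>

lemma alg_quot_simps [simp]:
  "carrier (alg_quot A I) = carrier (A Quot I)" "mult (alg_quot A I) = mult (A Quot I)"
  "one (alg_quot A I) = one (A Quot I)" "zero (alg_quot A I) = zero (A Quot I)"
  "add (alg_quot A I) = add (A Quot I)"
  by (simp_all add: alg_quot_def)

text \<open>Scaling a coset is defined as a union over all representatives. It is a single coset
  because c x' and c x differ by c i with i in I, which I absorbs.\<close>

lemma smult_alg_quot:
  assumes "ideal I A" "x \<in> carrier A"
    and cl: "\<And>x. x \<in> carrier A \<Longrightarrow> c \<odot>\<^bsub>A\<^esub> x \<in> carrier A"
    and dist: "\<And>x y. x \<in> carrier A \<Longrightarrow> y \<in> carrier A \<Longrightarrow>
      c \<odot>\<^bsub>A\<^esub> (x \<oplus>\<^bsub>A\<^esub> y) = c \<odot>\<^bsub>A\<^esub> x \<oplus>\<^bsub>A\<^esub> c \<odot>\<^bsub>A\<^esub> y"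
    and I: "\<And>x. x \<in> I \<Longrightarrow> c \<odot>\<^bsub>A\<^esub> x \<in> I"
  shows "c \<odot>\<^bsub>alg_quot A I\<^esub> (I +>\<^bsub>A\<^esub> x) = I +>\<^bsub>A\<^esub> (c \<odot>\<^bsub>A\<^esub> x)"
proof -
  interpret ideal I A by fact
  have eq: "I +>\<^bsub>A\<^esub> (c \<odot>\<^bsub>A\<^esub> x') = I +>\<^bsub>A\<^esub> (c \<odot>\<^bsub>A\<^esub> x)" if x': "x' \<in> I +>\<^bsub>A\<^esub> x" for x'
  proof -
    obtain i where i: "i \<in> I" "x' = i \<oplus>\<^bsub>A\<^esub> x"
      using x' unfolding a_r_coset_def' by blast
    then have "c \<odot>\<^bsub>A\<^esub> x' = c \<odot>\<^bsub>A\<^esub> i \<oplus>\<^bsub>A\<^esub> c \<odot>\<^bsub>A\<^esub> x"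
      using dist assms(2) by (simp add: a_Hcarr)
    then have "c \<odot>\<^bsub>A\<^esub> x' \<in> I +>\<^bsub>A\<^esub> (c \<odot>\<^bsub>A\<^esub> x)"
      using I[OF i(1)] unfolding a_r_coset_def' by blast
    then show ?thesis
      using a_repr_independence[OF _ cl[OF assms(2)] a_subgroup] by simp
  qed
  \<comment> \<open>A union of a constant family equals that constant only over a nonempty index
    set.\<close>
  have "I +>\<^bsub>A\<^esub> x \<noteq> {}" using a_rcos_self[OF assms(2)] by (metis empty_iff)
  then have "(\<Union>x'\<in>I +>\<^bsub>A\<^esub> x. I +>\<^bsub>A\<^esub> (c \<odot>\<^bsub>A\<^esub> x')) = I +>\<^bsub>A\<^esub> (c \<odot>\<^bsub>A\<^esub> x)"
    by (simp only: SUP_cong[OF refl eq] UN_constant if_False)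
  then show ?thesis by (simp only: alg_quot_def module.simps)
qed

text \<open>The abstract normal form: \<iota> is linear on the nose but multiplicative and unital
  only modulo J, while \<open>inj\<close> and \<open>surj\<close> say that its image is a complement
  of J. No ring axioms for A are included; they come in only with an ideal of A.\<close>

locale presentation = free_ideal J Y
  for J :: "('v list \<Rightarrow>\<^sub>0 'k::field) set" and Y +
  fixes A :: "('k, 'a) module" and \<iota> :: "'a \<Rightarrow> ('v list \<Rightarrow>\<^sub>0 'k)"
  assumes closed: "x \<in> carrier A \<Longrightarrow> \<iota> x \<in> free_carrier Y"
    and add: "x \<in> carrier A \<Longrightarrow> y \<in> carrier A \<Longrightarrow> \<iota> (x \<oplus>\<^bsub>A\<^esub> y) = \<iota> x + \<iota> y"
    and mult: "x \<in> carrier A \<Longrightarrow> y \<in> carrier A \<Longrightarrow> \<iota> (x \<otimes>\<^bsub>A\<^esub> y) - \<iota> x * \<iota> y \<in> J"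
    and one: "\<iota> \<one>\<^bsub>A\<^esub> - 1 \<in> J"
    and smult_closed: "x \<in> carrier A \<Longrightarrow> c \<odot>\<^bsub>A\<^esub> x \<in> carrier A"
    and smult: "x \<in> carrier A \<Longrightarrow> \<iota> (c \<odot>\<^bsub>A\<^esub> x) = psmult c (\<iota> x)"
    and inj: "x \<in> carrier A \<Longrightarrow> y \<in> carrier A \<Longrightarrow> \<iota> x - \<iota> y \<in> J \<Longrightarrow> x = y"
    and surj: "a \<in> free_carrier Y \<Longrightarrow> \<exists>x\<in>carrier A. a - \<iota> x \<in> J"
    and one_closed: "\<one>\<^bsub>A\<^esub> \<in> carrier A"
    and mult_closed: "x \<in> carrier A \<Longrightarrow> y \<in> carrier A \<Longrightarrow> x \<otimes>\<^bsub>A\<^esub> y \<in> carrier A"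
begin

context
  fixes K :: "('v list \<Rightarrow>\<^sub>0 'k) set"
  assumes K: "ideal K (free_alg Y)" and JK: "J \<subseteq> K"
begin

interpretation K: free_ideal K Y by (rule free_ideal.intro[OF K])

abbreviation "\<pi> x \<equiv> K +>\<^bsub>free_alg Y\<^esub> \<iota> x"

text \<open>Stated for any ideal K above J, so that it serves both the quotient by J itself and the
  quotient by the sum of J and an ideal of A.\<close>

lemma coset_ring_hom: "\<pi> \<in> ring_hom A (free_alg Y Quot K)"
proof (rule ring_hom_memI)
  fix x y assume xy: "x \<in> carrier A" "y \<in> carrier A"
  note c = closed[OF xy(1)] closed[OF xy(2)]
  show "\<pi> x \<in> carrier (free_alg Y Quot K)"
    using c by (auto simp: FactRing_def intro: a_rcosetsI[OF K.a_subset])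
  have "\<pi> (x \<otimes>\<^bsub>A\<^esub> y) = K +>\<^bsub>free_alg Y\<^esub> (\<iota> x * \<iota> y)"
    using mult[OF xy] JK c closed[OF mult_closed[OF xy]] by (subst K.coset_eq_iff) auto
  then show "\<pi> (x \<otimes>\<^bsub>A\<^esub> y) = \<pi> x \<otimes>\<^bsub>free_alg Y Quot K\<^esub> \<pi> y"
    using c K.rcoset_mult_add by (simp add: FactRing_def)
  show "\<pi> (x \<oplus>\<^bsub>A\<^esub> y) = \<pi> x \<oplus>\<^bsub>free_alg Y Quot K\<^esub> \<pi> y"
    using c K.a_rcos_sum by (simp add: FactRing_def add[OF xy])
next
  show "\<pi> \<one>\<^bsub>A\<^esub> = \<one>\<^bsub>free_alg Y Quot K\<^esub>"
    using one JK closed[OF one_closed] by (auto simp: FactRing_def K.coset_eq_iff)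
qed

lemma coset_image: "\<pi> ` carrier A = carrier (free_alg Y Quot K)"
proof
  show "\<pi> ` carrier A \<subseteq> carrier (free_alg Y Quot K)"
    using coset_ring_hom by (auto simp: ring_hom_def)
  show "carrier (free_alg Y Quot K) \<subseteq> \<pi> ` carrier A"
  proof
    fix C assume "C \<in> carrier (free_alg Y Quot K)"
    then obtain a where a: "a \<in> free_carrier Y" "C = K +>\<^bsub>free_alg Y\<^esub> a"
      by (auto simp: FactRing_def A_RCOSETS_def')
    obtain x where x: "x \<in> carrier A" "a - \<iota> x \<in> J" using surj[OF a(1)] by blast
    then have "C = \<pi> x" using a JK closed[OF x(1)] by (auto simp: K.coset_eq_iff)
    then show "C \<in> \<pi> ` carrier A" using x by blast
  qed
qed

lemma coset_smult: "x \<in> carrier A \<Longrightarrow> \<pi> (c \<odot>\<^bsub>A\<^esub> x) = c \<odot>\<^bsub>alg_quot (free_alg Y) K\<^esub> \<pi> x"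
  using smult_alg_quot[OF K, of "\<iota> x" c] K.J_scale closed
  by (simp add: smult pm.scale_right_distrib)

end

theorem iso_quotient: "alg_iso A (alg_quot (free_alg Y) J)"
proof -
  let ?h = "\<lambda>x. J +>\<^bsub>free_alg Y\<^esub> \<iota> x"
  have "inj_on ?h (carrier A)"
    by (rule inj_onI) (simp add: closed coset_eq_iff inj)
  then have "?h \<in> ring_iso A (alg_quot (free_alg Y) J)"
    using coset_ring_hom[OF is_ideal] coset_image[OF is_ideal]
    by (auto simp: ring_iso_def bij_betw_def ring_hom_def)
  then show ?thesis
    unfolding alg_iso_def using coset_smult[OF is_ideal]
    by (intro bexI[of _ ?h] allI ballI) auto
qed

context
  fixes I assumes I: "ideal I A"
begin

interpretation I: ideal I A by (rule I)

text \<open>A carries no vector space axioms. Such an identity is verified after applying \<iota>,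
  which is faithful modulo J.\<close>

lemma smult_add:
  assumes "x \<in> carrier A" "y \<in> carrier A"
  shows "c \<odot>\<^bsub>A\<^esub> (x \<oplus>\<^bsub>A\<^esub> y) = c \<odot>\<^bsub>A\<^esub> x \<oplus>\<^bsub>A\<^esub> c \<odot>\<^bsub>A\<^esub> y"
  by (rule inj) (use assms in \<open>simp_all add: smult_closed add smult pm.scale_right_distrib J_zero\<close>)

text \<open>This is what makes a ring ideal of A stable under scalars, which the quotient needs in
  order to be an algebra.\<close>

lemma smult_eq_mult:
  assumes x: "x \<in> carrier A"
  shows "c \<odot>\<^bsub>A\<^esub> x = (c \<odot>\<^bsub>A\<^esub> \<one>\<^bsub>A\<^esub>) \<otimes>\<^bsub>A\<^esub> x"
proof (rule inj[OF smult_closed I.m_closed, OF x smult_closed[OF one_closed] x])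
  have "psmult c (1 * \<iota> x - \<iota> \<one>\<^bsub>A\<^esub> * \<iota> x) \<in> J"
    by (intro J_scale J_mult J_sym[OF one]) (simp_all add: J_zero closed x)
  then have "\<iota> (c \<odot>\<^bsub>A\<^esub> x) - \<iota> (c \<odot>\<^bsub>A\<^esub> \<one>\<^bsub>A\<^esub>) * \<iota> x \<in> J"
    by (simp add: smult x one_closed pm.scale_right_diff_distrib)
  then show "\<iota> (c \<odot>\<^bsub>A\<^esub> x) - \<iota> ((c \<odot>\<^bsub>A\<^esub> \<one>\<^bsub>A\<^esub>) \<otimes>\<^bsub>A\<^esub> x) \<in> J"
    using J_sym[OF mult[OF smult_closed[OF one_closed] x]] by (rule J_trans)
qed

lemma smult_ideal: "x \<in> I \<Longrightarrow> c \<odot>\<^bsub>A\<^esub> x \<in> I"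
  using smult_eq_mult[of x c] I.I_l_closed[of x] smult_closed[OF one_closed] I.a_Hcarr by metis

abbreviation "K \<equiv> J <+>\<^bsub>free_alg Y\<^esub> \<iota> ` I"

text \<open>Membership in the sum becomes congruence to the image of an element of I, the form in
  which all closure properties are checked.\<close>

lemma mem_K: "a \<in> K \<longleftrightarrow> (\<exists>i\<in>I. a - \<iota> i \<in> J)"
proof
  assume "a \<in> K"
  then obtain j i where "j \<in> J" "i \<in> I" "a = j + \<iota> i" by (auto simp: set_add_def')
  then show "\<exists>i\<in>I. a - \<iota> i \<in> J" by (intro bexI[of _ i]) simp_all
next
  assume "\<exists>i\<in>I. a - \<iota> i \<in> J"
  then obtain i where "i \<in> I" "a - \<iota> i \<in> J" by blast
  then show "a \<in> K" unfolding set_add_def'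
    by simp (metis diff_add_cancel)
qed

text \<open>The image of I is not itself closed under multiplication by the free algebra. By
  \<open>surj\<close> a multiplier a is congruent to some \<iota> x, and then its products with an
  element congruent to \<iota> i are congruent to \<iota> of the products of x and i in A, which lie
  in I.\<close>

theorem sum_ideal: "ideal K (free_alg Y)"
proof (rule ideal_free_algI)
  show "K \<subseteq> free_carrier Y"
    using in_carrier closed I.a_Hcarr by (auto simp: set_add_def')
  \<comment> \<open>Additivity at 0 + 0 forces this value.\<close>
  have "\<iota> \<zero>\<^bsub>A\<^esub> = 0"
    using add[OF I.zero_closed I.zero_closed] by simp
  show "pm.subspace K"
  proof (rule pm.subspaceI)
    show "0 \<in> K"
      using additive_subgroup.zero_closed[OF I.is_additive_subgroup] \<open>\<iota> \<zero>\<^bsub>A\<^esub> = 0\<close> J_zero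
      by (auto simp: mem_K intro!: bexI[of _ "\<zero>\<^bsub>A\<^esub>"])
  next
    fix x y assume "x \<in> K" "y \<in> K"
    then obtain i j where ij: "i \<in> I" "j \<in> I" "x - \<iota> i \<in> J" "y - \<iota> j \<in> J"
      by (auto simp: mem_K)
    then have "x + y - \<iota> (i \<oplus>\<^bsub>A\<^esub> j) \<in> J"
      using J_add[OF ij(3,4)] by (simp add: add I.a_Hcarr algebra_simps)
    then show "x + y \<in> K" using ij additive_subgroup.a_closed[OF I.is_additive_subgroup] by (auto simp: mem_K)
  next
    fix c x assume "x \<in> K"
    then obtain i where i: "i \<in> I" "x - \<iota> i \<in> J" by (auto simp: mem_K)
    then have "psmult c x - \<iota> (c \<odot>\<^bsub>A\<^esub> i) \<in> J"
      using J_scale[OF i(2), of c] by (simp add: smult I.a_Hcarr pm.scale_right_diff_distrib)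
    then show "psmult c x \<in> K" using i smult_ideal by (auto simp: mem_K)
  qed
next
  fix k a :: "'v list \<Rightarrow>\<^sub>0 'k" assume "k \<in> K" and a: "a \<in> free_carrier Y"
  then obtain i where i: "i \<in> I" "k - \<iota> i \<in> J" by (auto simp: mem_K)
  then have iA: "i \<in> carrier A" by (simp add: I.a_Hcarr)
  obtain x where x: "x \<in> carrier A" "a - \<iota> x \<in> J" using surj[OF a] by blast
  have k: "k \<in> free_carrier Y"
    using in_carrier[OF i(2)] closed[OF iA] by (metis diff_add_cancel free_carrier_closed(2))
  have "a * k - \<iota> (x \<otimes>\<^bsub>A\<^esub> i) \<in> J"
    by (rule J_trans[OF J_mult[OF x(2) i(2)] J_sym[OF mult]]) (simp_all add: a closed iA x)
  then show "a * k \<in> K" using I.I_l_closed i x by (auto simp: mem_K)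
  have "k * a - \<iota> (i \<otimes>\<^bsub>A\<^esub> x) \<in> J"
    by (rule J_trans[OF J_mult[OF i(2) x(2)] J_sym[OF mult]]) (simp_all add: k closed iA x)
  then show "k * a \<in> K" using I.I_r_closed i x by (auto simp: mem_K)
qed

text \<open>First isomorphism theorem for the coset map of A onto the quotient by K. Its kernel is
  exactly I: if \<iota> x is congruent to \<iota> i with i in I, then x = i by
  \<open>inj\<close>.\<close>

theorem iso_quotient_sum: "alg_iso (alg_quot A I) (alg_quot (free_alg Y) K)"
proof -
  interpret K: free_ideal K Y by (rule free_ideal.intro[OF sum_ideal])
  let ?h = "\<lambda>x. K +>\<^bsub>free_alg Y\<^esub> \<iota> x"
  have JK: "J \<subseteq> K"
    using additive_subgroup.zero_closed[OF I.is_additive_subgroup] add[OF I.zero_closed I.zero_closed]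
    by (auto simp: mem_K intro!: bexI[of _ "\<zero>\<^bsub>A\<^esub>"])
  note hom = coset_ring_hom[OF sum_ideal JK]
    and img = coset_image[OF sum_ideal JK] and sm = coset_smult[OF sum_ideal JK]
  interpret h: ring_hom_ring A "free_alg Y Quot K" ?h
    by (rule ring_hom_ringI2[OF I.ring_axioms K.quotient_is_ring hom])
  have ker: "a_kernel A (free_alg Y Quot K) ?h = I"
  proof -
    have "?h x = K \<longleftrightarrow> x \<in> I" if x: "x \<in> carrier A" for x
    proof -
      have "?h x = K \<longleftrightarrow> ?h x = K +>\<^bsub>free_alg Y\<^esub> 0"
        using a_rcos_zero[OF sum_ideal, of 0] K.J_zero by simp
      also have "\<dots> \<longleftrightarrow> \<iota> x \<in> K" using closed[OF x] by (simp add: K.coset_eq_iff)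
      also have "\<dots> \<longleftrightarrow> x \<in> I"
        proof
        assume "\<iota> x \<in> K"
        then obtain i where i: "i \<in> I" "\<iota> x - \<iota> i \<in> J" by (auto simp: mem_K)
        then show "x \<in> I" using inj[OF x I.a_Hcarr] by blast
      next
        assume "x \<in> I"
        then show "\<iota> x \<in> K" unfolding mem_K by (intro bexI[of _ x]) (simp_all add: J_zero)
      qed
      finally show ?thesis .
    qed
    then have "{x \<in> carrier A. ?h x = K} = I"
      using I.a_Hcarr by blast
    then show ?thesis
      by (simp only: a_kernel_def' FactRing_def ring.simps)
  qed
  let ?\<phi> = "\<lambda>C. the_elem (?h ` C)"
  \<comment> \<open>The ring isomorphism is given abstractly; its explicit value on cosets is needed
    to check compatibility with scalars.\<close>
  have val: "?\<phi> (I +>\<^bsub>A\<^esub> x) = ?h x" if "x \<in> carrier A" for x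
    using h.the_elem_simp[OF that] by (simp add: ker)
  have "?\<phi> \<in> ring_iso (A Quot I) (free_alg Y Quot K)"
    using h.FactRing_iso_set[OF img] by (simp add: ker)
  then have "?\<phi> \<in> ring_iso (alg_quot A I) (alg_quot (free_alg Y) K)"
    by (simp add: ring_iso_def ring_hom_def)
  moreover have "?\<phi> (c \<odot>\<^bsub>alg_quot A I\<^esub> C) = c \<odot>\<^bsub>alg_quot (free_alg Y) K\<^esub> ?\<phi> C"
    if C: "C \<in> carrier (alg_quot A I)" for c C
  proof -
    obtain x where x: "x \<in> carrier A" "C = I +>\<^bsub>A\<^esub> x"
      using C unfolding alg_quot_simps FactRing_def A_RCOSETS_def' by auto
    have "c \<odot>\<^bsub>alg_quot A I\<^esub> C = I +>\<^bsub>A\<^esub> (c \<odot>\<^bsub>A\<^esub> x)"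
      unfolding x(2)
      by (rule smult_alg_quot[OF I x(1)]) (simp_all add: smult_closed smult_add smult_ideal)
    then show ?thesis by (simp add: val x smult_closed sm)
  qed
  ultimately show ?thesis
    unfolding alg_iso_def by (intro bexI[of _ ?\<phi>] allI ballI)
qed

end

end

section \<open>Substitution\<close>

text \<open>Both sides are bilinear in p and q, so each factor is expanded into words in
  turn.\<close>

lemma linear_multiplicative:
  fixes T :: "('v list \<Rightarrow>\<^sub>0 'k::field) \<Rightarrow> ('w::monoid_add \<Rightarrow>\<^sub>0 'k)"
  assumes "Vector_Spaces.linear psmult psmult T"
    and "\<And>u v. T (Poly_Mapping.single (u @ v) 1)
        = T (Poly_Mapping.single u 1) * T (Poly_Mapping.single v 1)"
  shows "T (p * q) = T p * T q"
proof -
  note T = linear_eq_lin_ext[OF assms(1)]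
  have word: "T (Poly_Mapping.single u 1 * q) = T (Poly_Mapping.single u 1) * T q" for u
  proof -
    have "T (Poly_Mapping.single u 1 * q)
        = T (lin_ext psmult (\<lambda>v. Poly_Mapping.single u 1 * Poly_Mapping.single v 1) q)"
      by (simp only: mult_lin_ext[symmetric] lin_ext_basis)
    also have "\<dots> = lin_ext psmult
        (\<lambda>v. T (Poly_Mapping.single u 1) * T (Poly_Mapping.single v 1)) q"
      by (simp add: linear_lin_ext_apply[OF assms(1)] assms(2))
    also have "\<dots> = T (Poly_Mapping.single u 1) * T q"
      by (simp flip: mult_lin_ext T)
    finally show ?thesis .
  qed
  have "T (p * q) = T (lin_ext psmult (\<lambda>u. Poly_Mapping.single u 1 * q) p)"
    by (simp flip: lin_ext_mult)
  also have "\<dots> = lin_ext psmult (\<lambda>u. T (Poly_Mapping.single u 1) * T q) p"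
    by (simp add: linear_lin_ext_apply[OF assms(1)] word)
  also have "\<dots> = T p * T q"
    by (simp flip: lin_ext_mult T)
  finally show ?thesis .
qed

definition subst_vars :: "('s \<Rightarrow> ('s list \<Rightarrow>\<^sub>0 'k::field)) \<Rightarrow> ('s list \<Rightarrow>\<^sub>0 'k) \<Rightarrow> ('s list \<Rightarrow>\<^sub>0 'k)"
  where "subst_vars f = lin_ext psmult (\<lambda>w. prod_list (map f w))"

lemma linear_subst_vars: "Vector_Spaces.linear psmult psmult (subst_vars f)"
  unfolding subst_vars_def by (rule pm.linear_lin_ext)

lemma subst_vars_single [simp]: "subst_vars f (Poly_Mapping.single w 1) = prod_list (map f w)"
  by (simp add: subst_vars_def)

lemma subst_vars_mult: "subst_vars f (p * q) = subst_vars f p * subst_vars f q"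
  by (rule linear_multiplicative[OF linear_subst_vars]) simp

text \<open>Makes the substitution a retraction onto k<X>, so its kernel meets k<X> only in
  0.\<close>

lemma subst_vars_id:
  assumes "p \<in> free_carrier X" "\<And>x. x \<in> X \<Longrightarrow> f x = var x"
  shows "subst_vars f p = p"
  using assms(1)
proof (induction rule: free_carrier_induct)
  case (word u)
  then have "prod_list (map f u) = Poly_Mapping.single u 1"
    by (induction u) (simp_all add: assms(2) single_Cons)
  then show ?case by simp
qed (simp_all add: subst_vars_def pm.lin_ext_add pm.lin_ext_psmult)

lemma ideal_kernel:
  fixes T :: "('v list \<Rightarrow>\<^sub>0 'k::field) \<Rightarrow> ('w::monoid_add \<Rightarrow>\<^sub>0 'k)"
  assumes "Vector_Spaces.linear psmult psmult T" and T: "\<And>p q. T (p * q) = T p * T q"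
  shows "ideal {p \<in> free_carrier Y. T p = 0} (free_alg Y)"
proof (rule ideal_free_algI)
  have "pm.subspace (free_carrier Y \<inter> {p. T p \<in> {0}})"
    by (intro pm.subspace_inter free_carrier_subspace linear_subspace_vimage[OF assms(1)]
        pm.subspace_single_0)
  then show "pm.subspace {p \<in> free_carrier Y. T p = 0}"
    by (simp add: Int_def)
qed (auto simp: T)

text \<open>The normal form map is the inclusion. If x - y lies in the ideal, substitution kills it,
  yet fixes it as an element of k<X>.\<close>

lemma presentation_plain:
  assumes XS: "X \<subseteq> S" and f: "\<And>s. s \<in> S \<Longrightarrow> f s \<in> free_carrier X"
    and fX: "\<And>x. x \<in> X \<Longrightarrow> f x = var x"
  shows "presentation (I_S_plain S f) S (free_alg X) (\<lambda>p. p)"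
proof -
  have sub: "free_carrier X \<subseteq> free_carrier S"
    using XS by (auto simp: free_carrier_def)
  interpret F: ring "free_alg S" by (rule ring_free_alg)
  let ?B = "{var s - f s |s. s \<in> S}"
  have B: "?B \<subseteq> carrier (free_alg S)" using f sub by auto
  interpret J: free_ideal "I_S_plain S f" S
    unfolding I_S_plain_def by (rule free_ideal.intro[OF F.genideal_ideal[OF B]])
  have gen: "var s - f s \<in> I_S_plain S f" if "s \<in> S" for s
    using F.genideal_self[OF B] that by (auto simp: I_S_plain_def)
  have "I_S_plain S f \<subseteq> {p \<in> free_carrier S. subst_vars f p = 0}"
    unfolding I_S_plain_def
  proof (rule F.genideal_minimal[OF ideal_kernel[OF linear_subst_vars subst_vars_mult]])
    \<comment> \<open>The letter s goes to f s, and f s, lying in k<X>, is fixed; the difference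
      vanishes.\<close>
    show "?B \<subseteq> {p \<in> free_carrier S. subst_vars f p = 0}"
      using B f subst_vars_id[of _ X f] fX
      by (auto simp: subst_vars_def pm.lin_ext_diff var_def)
  qed
  then have kill: "subst_vars f p = 0" if "p \<in> I_S_plain S f" for p using that by auto
  have surj: "\<exists>x\<in>free_carrier X. a - x \<in> I_S_plain S f" if "a \<in> free_carrier S" for a
    using that
  proof (induction rule: free_carrier_induct)
    case (add p q)
    then obtain x y where "x \<in> free_carrier X" "y \<in> free_carrier X"
      "p - x \<in> I_S_plain S f" "q - y \<in> I_S_plain S f" by blast
    then show ?case
      using J.J_add[of "p - x" "q - y"] by (intro bexI[of _ "x + y"]) (auto simp: algebra_simps)
  next
    case (scale c p)
    then obtain x where "x \<in> free_carrier X" "p - x \<in> I_S_plain S f" by blast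
    then show ?case
      using J.J_scale[of "p - x" c]
      by (intro bexI[of _ "psmult c x"]) (auto simp: pm.scale_right_diff_distrib)
  next
    case (word u)
    then show ?case
    proof (induction u)
      case Nil
      show ?case by (intro bexI[of _ 1]) (simp_all add: J.J_zero)
    next
      case (Cons s u)
      then obtain x where x: "x \<in> free_carrier X" "Poly_Mapping.single u 1 - x \<in> I_S_plain S f"
        by auto
      have "var s * Poly_Mapping.single u 1 - f s * x \<in> I_S_plain S f"
        using Cons x sub by (intro J.J_mult gen) auto
      \<comment> \<open>The leading letter s is replaced by f s, and the tail by its representative
        x from the induction.\<close>
      then show ?case
        using Cons x f by (intro bexI[of _ "f s * x"]) (auto simp: single_Cons)
    qed
  qed
  show ?thesis
  proof unfold_locales
    fix x y assume xy: "x \<in> carrier (free_alg X)" "y \<in> carrier (free_alg X)"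
      "x - y \<in> I_S_plain S f"
    then have "subst_vars f (x - y) = 0" by (intro kill)
    then show "x = y"
      using xy subst_vars_id[OF _ fX, of "x - y" X] by simp
  qed (use sub surj in \<open>auto simp: J.J_zero\<close>)
qed

section \<open>Multilinear maps on tensors\<close>

definition bilinear :: "('k::field \<Rightarrow> 'h::ab_group_add \<Rightarrow> 'h) \<Rightarrow> ('h \<Rightarrow> 'h \<Rightarrow> ('x \<Rightarrow>\<^sub>0 'k)) \<Rightarrow> bool" where
  "bilinear s \<phi> \<longleftrightarrow> (\<forall>a. Vector_Spaces.linear s psmult (\<phi> a)) \<and>
     (\<forall>b. Vector_Spaces.linear s psmult (\<lambda>a. \<phi> a b))"

definition trilinear ::
  "('k::field \<Rightarrow> 'h::ab_group_add \<Rightarrow> 'h) \<Rightarrow> ('h \<Rightarrow> 'h \<Rightarrow> 'h \<Rightarrow> ('x \<Rightarrow>\<^sub>0 'k)) \<Rightarrow> bool" where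
  "trilinear s \<phi> \<longleftrightarrow> (\<forall>a b. Vector_Spaces.linear s psmult (\<phi> a b)) \<and>
     (\<forall>a c. Vector_Spaces.linear s psmult (\<lambda>b. \<phi> a b c)) \<and>
     (\<forall>b c. Vector_Spaces.linear s psmult (\<lambda>a. \<phi> a b c))"

lemma linear_map_add: "Vector_Spaces.linear s1 s2 T \<Longrightarrow> T (x + y) = T x + T y"
  by (simp add: Vector_Spaces.linear_def module_hom_def module_hom_axioms_def)

lemma linear_map_scale: "Vector_Spaces.linear s1 s2 T \<Longrightarrow> T (s1 c x) = s2 c (T x)"
  by (simp add: Vector_Spaces.linear_def module_hom_def module_hom_axioms_def)

text \<open>Universal property of a quotient: a linear map that kills the relations takes equal
  values on equivalent representatives.\<close>

lemma eq_lin_ext_if_diff_in_span: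
  assumes "p - q \<in> pm.span B" "\<And>b. b \<in> B \<Longrightarrow> lin_ext psmult \<phi> b = 0"
  shows "lin_ext psmult \<phi> p = lin_ext psmult \<phi> q"
proof -
  have "pm.subspace {x. lin_ext psmult \<phi> x \<in> {0}}"
    by (rule linear_subspace_vimage[OF pm.linear_lin_ext pm.subspace_single_0])
  then have "pm.span B \<subseteq> {x. lin_ext psmult \<phi> x \<in> {0}}"
    by (intro pm.span_minimal) (auto simp: assms(2))
  then show ?thesis using assms(1) by (auto simp: pm.lin_ext_diff)
qed

text \<open>A bilinear map factors through the tensor product. This turns the bialgebra axioms
  stated by \<open>tensor_eq\<close> into genuine equations.\<close>

lemma lin_ext_tensor_eq:
  assumes "bilinear s \<phi>" "tensor_eq s p q"
  shows "lin_ext psmult (\<lambda>(a, b). \<phi> a b) p = lin_ext psmult (\<lambda>(a, b). \<phi> a b) q"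
proof (rule eq_lin_ext_if_diff_in_span[OF assms(2)[unfolded tensor_eq_def tensor_null_def]], goal_cases)
  case (1 x)
  have l: "Vector_Spaces.linear s psmult (\<phi> a)" "Vector_Spaces.linear s psmult (\<lambda>a. \<phi> a b)" for a b
    using assms(1) by (auto simp: bilinear_def)
  note simps = pm.lin_ext_diff linear_map_add[OF l(1)] linear_map_add[OF l(2)]
    linear_map_scale[OF l(1)] linear_map_scale[OF l(2)]
  from 1 show ?case
    by (elim UnE CollectE exE conjE) (simp_all add: simps)
qed

lemma lin_ext_tensor3_eq:
  assumes "trilinear s \<phi>" "tensor3_eq s p q"
  shows "lin_ext psmult (\<lambda>(a, b, c). \<phi> a b c) p = lin_ext psmult (\<lambda>(a, b, c). \<phi> a b c) q"
proof (rule eq_lin_ext_if_diff_in_span[OF assms(2)[unfolded tensor3_eq_def tensor3_null_def]], goal_cases)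
  case (1 x)
  have l: "Vector_Spaces.linear s psmult (\<phi> a b)" "Vector_Spaces.linear s psmult (\<lambda>b. \<phi> a b c)"
    "Vector_Spaces.linear s psmult (\<lambda>a. \<phi> a b c)" for a b c
    using assms(1) by (auto simp: trilinear_def)
  note simps = pm.lin_ext_diff
    linear_map_add[OF l(1)] linear_map_add[OF l(2)] linear_map_add[OF l(3)]
    linear_map_scale[OF l(1)] linear_map_scale[OF l(2)] linear_map_scale[OF l(3)]
  from 1 show ?case
    by (elim UnE CollectE exE conjE) (simp_all add: simps)
qed

text \<open>Interchange of finite sums; needed because composing operators nests the two coproducts
  in the opposite order from the coproduct of a product.\<close>

lemma lin_ext_swap:
  fixes \<phi> :: "'a \<Rightarrow> 'b \<Rightarrow> ('c \<Rightarrow>\<^sub>0 'k::field)"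
  shows "lin_ext psmult (\<lambda>x. lin_ext psmult (\<phi> x) q) p
    = lin_ext psmult (\<lambda>y. lin_ext psmult (\<lambda>x. \<phi> x y) p) q"
  by (simp add: lin_ext_def pm.scale_sum_right mult.commute)
    (rule sum.swap)

context bialgebra
begin

abbreviation sweedler :: "('h \<Rightarrow> 'h \<Rightarrow> ('x \<Rightarrow>\<^sub>0 'k)) \<Rightarrow> 'h \<Rightarrow> ('x \<Rightarrow>\<^sub>0 'k)" where
  "sweedler \<phi> h \<equiv> lin_ext psmult (\<lambda>(a, b). \<phi> a b) (\<Delta> h)"

lemma linear_psmult_targetI:
  assumes "\<And>x y. T (x + y) = T x + T y" "\<And>c x. T (scale c x) = psmult c (T x)"
  shows "Vector_Spaces.linear scale psmult T"
  by (intro Vector_Spaces.linear.intro module_hom.intro module_hom_axioms.intro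
      pm.module_axioms pm.vector_space_axioms vector_space_axioms module_axioms assms)

lemma bilinearI:
  assumes "\<And>a x y. \<phi> a (x + y) = \<phi> a x + \<phi> a y" "\<And>a c x. \<phi> a (scale c x) = psmult c (\<phi> a x)"
    and "\<And>b x y. \<phi> (x + y) b = \<phi> x b + \<phi> y b" "\<And>b c x. \<phi> (scale c x) b = psmult c (\<phi> x b)"
  shows "bilinear scale \<phi>"
  unfolding bilinear_def by (intro conjI allI linear_psmult_targetI assms)

lemma trilinearI:
  assumes "\<And>a b x y. \<phi> a b (x + y) = \<phi> a b x + \<phi> a b y"
    and "\<And>a b c x. \<phi> a b (scale c x) = psmult c (\<phi> a b x)"
    and "\<And>a b x y. \<phi> a (x + y) b = \<phi> a x b + \<phi> a y b"
    and "\<And>a b c x. \<phi> a (scale c x) b = psmult c (\<phi> a x b)"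
    and "\<And>a b x y. \<phi> (x + y) a b = \<phi> x a b + \<phi> y a b"
    and "\<And>a b c x. \<phi> (scale c x) a b = psmult c (\<phi> x a b)"
  shows "trilinear scale \<phi>"
  unfolding trilinear_def by (intro conjI allI linear_psmult_targetI assms)

text \<open>\<Delta> is additive only up to the tensor relations, hence the demand for
  bilinearity.\<close>

lemma sweedler_add:
  "bilinear scale \<phi> \<Longrightarrow> sweedler \<phi> (g + h) = sweedler \<phi> g + sweedler \<phi> h"
  using lin_ext_tensor_eq[OF _ comult_add] by (metis pm.lin_ext_add)

lemma sweedler_scale: "bilinear scale \<phi> \<Longrightarrow> sweedler \<phi> (scale c h) = psmult c (sweedler \<phi> h)"
  using lin_ext_tensor_eq[OF _ comult_scale] by (metis pm.lin_ext_psmult)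

lemma sweedler_one: "bilinear scale \<phi> \<Longrightarrow> sweedler \<phi> 1 = \<phi> 1 1"
  using lin_ext_tensor_eq[OF _ comult_one, of \<phi>] by simp

lemma sweedler_mult:
  assumes "bilinear scale \<phi>"
  shows "sweedler \<phi> (g * h) = sweedler (\<lambda>a b. sweedler (\<lambda>c d. \<phi> (a * c) (b * d)) h) g"
  using lin_ext_tensor_eq[OF assms comult_mult, of g h]
  by (simp add: tensor_mult_def pm.lin_ext_lin_ext split_def)

lemma sweedler_coassoc:
  assumes "trilinear scale \<psi>"
  shows "sweedler (\<lambda>a b. sweedler (\<lambda>c d. \<psi> c d b) a) h
    = sweedler (\<lambda>a b. sweedler (\<lambda>c d. \<psi> a c d) b) h"
  using lin_ext_tensor3_eq[OF assms coassoc, of h]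
  by (simp add: pm.lin_ext_lin_ext split_def)

lemma sweedler_counit:
  assumes "Vector_Spaces.linear scale psmult T"
  shows "sweedler (\<lambda>a b. psmult (\<epsilon> a) (T b)) h = T h"
  using linear_lin_ext_apply[OF assms, of "\<lambda>(a, b). scale (\<epsilon> a) b" "\<Delta> h"]
  using counit_left[of h] by (simp add: linear_map_scale[OF assms] split_def)

lemma sweedler_linear:
  assumes "Vector_Spaces.linear psmult psmult T"
  shows "T (sweedler \<phi> h) = sweedler (\<lambda>a b. T (\<phi> a b)) h"
  using linear_lin_ext_apply[OF assms, of "\<lambda>(a, b). \<phi> a b" "\<Delta> h"] by (simp add: split_def)

end

section \<open>Coordinates\<close>

locale based_space = vector_space scale
  for scale :: "'k::field \<Rightarrow> 'h::ring_1 \<Rightarrow> 'h" +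
  fixes G :: "'h set"
  assumes basis: "is_basis scale G" and one_in_basis: "1 \<in> G"
begin

lemma indep: "independent G" and span_UNIV: "span G = UNIV"
  using basis by (simp_all add: is_basis_def)

lemma lookup_coords [simp]: "Poly_Mapping.lookup (coords scale G h) g = representation G h g"
  by (auto simp: coords_def lookup_sum lookup_single when_def sum.delta finite_representation)

lemma keys_coords: "Poly_Mapping.keys (coords scale G h) \<subseteq> G"
  by (auto simp: in_keys_iff dest: representation_ne_zero)

lemma coords_add: "coords scale G (g + h) = coords scale G g + coords scale G h"
  by (rule poly_mapping_eqI) (simp add: lookup_add representation_add indep span_UNIV)

lemma coords_scale: "coords scale G (scale c h) = psmult c (coords scale G h)"
  by (rule poly_mapping_eqI) (simp add: representation_scale indep span_UNIV)

lemma coords_basis: "g \<in> G \<Longrightarrow> coords scale G g = Poly_Mapping.single g 1"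
  by (rule poly_mapping_eqI) (simp add: representation_basis indep lookup_single when_def)

lemma basis_induct [case_names add scale basis]:
  assumes "\<And>g h. P g \<Longrightarrow> P h \<Longrightarrow> P (g + h)" "\<And>c h. P h \<Longrightarrow> P (scale c h)"
    and "\<And>g. g \<in> G \<Longrightarrow> P g"
  shows "P h"
proof -
  \<comment> \<open>The unit lies in G, so there is a vector to scale by 0.\<close>
  have "P 0" using assms(2)[OF assms(3)[OF one_in_basis], of 0] by simp
  then have "subspace {h. P h}" by (intro subspaceI) (auto intro: assms)
  then have "span G \<subseteq> {h. P h}" using assms(3) by (intro span_minimal) auto
  then show ?thesis by (simp add: span_UNIV subset_iff)
qed

lemma hvar_add: "hvar scale G (g + h) = hvar scale G g + hvar scale G h"
  by (simp add: hvar_def coords_add pm.lin_ext_add)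

lemma hvar_scale: "hvar scale G (scale c h) = psmult c (hvar scale G h)"
  by (simp add: hvar_def coords_scale pm.lin_ext_psmult)

lemma hvar_basis: "g \<in> G \<Longrightarrow> hvar scale G g = var (Inr g)"
  by (simp add: hvar_def coords_basis)

lemma hvar_in_free_carrier [simp, intro]: "hvar scale G h \<in> free_carrier (Inl ` S \<union> Inr ` G)"
  unfolding hvar_def
  by (rule pm.lin_ext_in_subspace[OF free_carrier_subspace]) (use keys_coords in blast)

lemma tens_add_left: "tens scale G (p + q) h = tens scale G p h + tens scale G q h"
  by (simp add: tens_def pm.lin_ext_add)

lemma tens_scale_left: "tens scale G (psmult c p) h = psmult c (tens scale G p h)"
  by (simp add: tens_def pm.lin_ext_psmult)

lemma tens_add_right: "tens scale G p (g + h) = tens scale G p g + tens scale G p h"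
  by (simp add: tens_def coords_add pm.lin_ext_add pm.lin_ext_fun_add)

lemma tens_scale_right: "tens scale G p (scale c h) = psmult c (tens scale G p h)"
  by (simp add: tens_def coords_scale pm.lin_ext_psmult pm.lin_ext_fun_scale)

lemma tens_basis: "g \<in> G \<Longrightarrow> tens scale G (Poly_Mapping.single u 1) g = Poly_Mapping.single (u, g) 1"
  by (simp add: tens_def coords_basis)

end

section \<open>The embeddings of k<X> and of the smash product into the algebra on S and G\<close>

lemma linear_emb: "Vector_Spaces.linear psmult psmult emb"
  unfolding emb_def by (rule pm.linear_lin_ext)

lemma emb_add: "emb (p + q) = emb p + emb q"
  by (rule linear_map_add[OF linear_emb])

lemma emb_scale: "emb (psmult c p) = psmult c (emb p)"
  by (rule linear_map_scale[OF linear_emb])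

lemma emb_single [simp]: "emb (Poly_Mapping.single u c) = Poly_Mapping.single (map Inl u) c"
  by (simp add: emb_def)

lemma emb_one [simp]: "emb 1 = 1"
  unfolding single_Nil_1[symmetric] emb_single by simp

lemma emb_var: "emb (var x) = var (Inl x)"
  by (simp add: var_def)

lemma emb_mult: "emb (p * q) = emb p * emb q"
  by (rule linear_multiplicative[OF linear_emb]) simp

lemma emb_in_free_carrier [intro]: "p \<in> free_carrier S \<Longrightarrow> emb p \<in> free_carrier (Inl ` S \<union> Inr ` G)"
  unfolding emb_def
  by (rule pm.lin_ext_in_subspace[OF free_carrier_subspace]) (fastforce simp: free_carrier_def)

lemma linear_incl: "Vector_Spaces.linear psmult psmult incl"
  unfolding incl_def by (rule pm.linear_lin_ext)

lemma incl_single: "incl (Poly_Mapping.single (u, g) 1) = Poly_Mapping.single (map Inl u) 1 * var (Inr g)"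
  by (simp add: incl_def var_def)

text \<open>Holds for every h in H, not only for h in G, and so covers the second factors produced
  by the smash product.\<close>

lemma incl_tens: "incl (tens scale G p h) = emb p * hvar scale G h"
  unfolding tens_def incl_def emb_def hvar_def lin_ext_mult
  by (simp add: pm.lin_ext_lin_ext mult_lin_ext var_def)

section \<open>The relations of the smash product\<close>

text \<open>The clause \<open>f_var\<close> lets letters of X keep their meaning in the quotient, so
  that only letters outside X are eliminated.\<close>

locale smash_data = module_algebra scale \<Delta> \<epsilon> psmult "free_carrier X" act + based_space scale G
  for scale :: "'k::field \<Rightarrow> 'h::ring_1 \<Rightarrow> 'h" and \<Delta> \<epsilon>
    and X :: "'s set" and act :: "'h \<Rightarrow> ('s list \<Rightarrow>\<^sub>0 'k) \<Rightarrow> ('s list \<Rightarrow>\<^sub>0 'k)" and G +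
  fixes S :: "'s set" and f :: "'s \<Rightarrow> ('s list \<Rightarrow>\<^sub>0 'k)"
  assumes X_subset: "X \<subseteq> S"
    and f_closed: "s \<in> S \<Longrightarrow> f s \<in> free_carrier X"
    and f_var: "x \<in> X \<Longrightarrow> f x = var x"
begin

abbreviation "Y \<equiv> Inl ` S \<union> Inr ` G"
abbreviation "J \<equiv> I_S S G f <+>\<^bsub>free_SG S G\<^esub> I_G scale \<Delta> act S G f"
abbreviation "tensor \<equiv> tens scale G"
abbreviation "hv \<equiv> hvar scale G"

lemma free_carrier_mono: "p \<in> free_carrier X \<Longrightarrow> p \<in> free_carrier S"
  using X_subset by (auto simp: free_carrier_def)

lemma emb_closed [simp, intro]: "p \<in> free_carrier X \<Longrightarrow> emb p \<in> free_carrier Y"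
  by (intro emb_in_free_carrier free_carrier_mono)

lemmas act_simps = act_closed act_add_left act_scale_left act_add_right act_scale_right

lemma bilinear_emb_hvar: "p \<in> free_carrier X \<Longrightarrow> bilinear scale (\<lambda>a b. emb (act a p) * hv b)"
  by (rule bilinearI)
    (simp_all add: act_simps emb_add emb_scale hvar_add hvar_scale algebra_simps)

lemma bilinear_tens: "p \<in> free_carrier X \<Longrightarrow> bilinear scale (\<lambda>a b. tensor (act a p) (b * h))"
  by (rule bilinearI)
    (simp_all add: act_simps tens_add_left tens_add_right tens_scale_left tens_scale_right
      scale_mult_left algebra_simps)

definition gens_S :: "(('s + 'h) list \<Rightarrow>\<^sub>0 'k) set" where
  "gens_S = {var (Inl s) - emb (f s) | s. s \<in> S}"

definition gens_G :: "(('s + 'h) list \<Rightarrow>\<^sub>0 'k) set" where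
  "gens_G = {var (Inr g) * var (Inl s) - sweedler (\<lambda>a b. emb (act a (f s)) * hv b) g | g s. g \<in> G \<and> s \<in> S} \<union>
      {var (Inr g) * var (Inr h) - hv (g * h) | g h. g \<in> G \<and> h \<in> G} \<union>
      {var (Inr 1) - 1}"

lemma sweedler_closed [intro]:
  "(\<And>a b. \<phi> a b \<in> free_carrier Z) \<Longrightarrow> sweedler \<phi> h \<in> free_carrier Z"
  by (intro pm.lin_ext_in_subspace[OF free_carrier_subspace]) auto

lemma gens_closed: "gens_S \<subseteq> free_carrier Y" "gens_G \<subseteq> free_carrier Y"
proof -
  show "gens_S \<subseteq> free_carrier Y"
    unfolding gens_S_def using f_closed by (auto intro!: free_carrier_closed)
  show "gens_G \<subseteq> free_carrier Y"
    unfolding gens_G_def using f_closed one_in_basis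
    by (auto intro!: free_carrier_closed free_carrier_mult act_closed)
qed

lemma I_S_eq: "I_S S G f = Idl\<^bsub>free_alg Y\<^esub> gens_S"
  by (simp add: I_S_def gens_S_def free_SG_def)

lemma I_G_eq: "I_G scale \<Delta> act S G f = Idl\<^bsub>free_alg Y\<^esub> gens_G"
  by (simp add: I_G_def gens_G_def free_SG_def)

sublocale F: ring "free_alg Y :: ('k, ('s + 'h) list \<Rightarrow>\<^sub>0 'k) module"
  by (rule ring_free_alg)

lemma ideal_I_S: "ideal (I_S S G f) (free_alg Y)"
  unfolding I_S_eq by (rule F.genideal_ideal) (simp add: gens_closed)

lemma ideal_I_G: "ideal (I_G scale \<Delta> act S G f) (free_alg Y)"
  unfolding I_G_eq by (rule F.genideal_ideal) (simp add: gens_closed)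

sublocale J: free_ideal J Y
  unfolding free_SG_def by (rule free_ideal.intro[OF F.add_ideals[OF ideal_I_S ideal_I_G]])

lemma gens_in_J: "gens_S \<subseteq> J" "gens_G \<subseteq> J"
proof -
  interpret S: free_ideal "I_S S G f" Y by (rule free_ideal.intro[OF ideal_I_S])
  interpret G: free_ideal "I_G scale \<Delta> act S G f" Y by (rule free_ideal.intro[OF ideal_I_G])
  have "I_S S G f \<subseteq> J" "I_G scale \<Delta> act S G f \<subseteq> J"
    using S.J_zero G.J_zero by (force simp: set_add_def' free_SG_def)+
  then show "gens_S \<subseteq> J" "gens_G \<subseteq> J"
    using F.genideal_self[of gens_S] F.genideal_self[of gens_G]
    by (auto simp: I_S_eq I_G_eq gens_closed)
qed

lemma
  shows J_S: "s \<in> S \<Longrightarrow> var (Inl s) - emb (f s) \<in> J"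
    and J_GS: "g \<in> G \<Longrightarrow> s \<in> S \<Longrightarrow>
      var (Inr g) * var (Inl s) - sweedler (\<lambda>a b. emb (act a (f s)) * hv b) g \<in> J"
    and J_GG: "g \<in> G \<Longrightarrow> h \<in> G \<Longrightarrow> var (Inr g) * var (Inr h) - hv (g * h) \<in> J"
    and J_1: "var (Inr 1) - 1 \<in> J"
  using gens_in_J unfolding gens_S_def gens_G_def by blast+

section \<open>Straightening rules modulo \<open>J\<close>\<close>

lemma J_sweedler:
  "(\<And>a b. \<phi> a b - \<psi> a b \<in> J) \<Longrightarrow> sweedler \<phi> h - sweedler \<psi> h \<in> J"
  by (rule J.J_lin_ext) auto

text \<open>The generators give this for g and h in G; bilinearity extends it to H, as required for
  products with the second leg of a coproduct.\<close>

lemma hvar_mult: "hv g * hv h - hv (g * h) \<in> J"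
proof (induction g rule: basis_induct)
  case (add g g')
  then show ?case using J.J_add[OF add] by (simp add: hvar_add algebra_simps)
next
  case (scale c g)
  then show ?case
    using J.J_scale[OF scale, of c]
    by (simp add: hvar_scale scale_mult_left pm.scale_right_diff_distrib)
next
  case g: (basis g)
  show ?case
  proof (induction h rule: basis_induct)
    case (add h h')
    then show ?case using J.J_add[OF add] by (simp add: hvar_add algebra_simps)
  next
    case (scale c h)
    then show ?case
      using J.J_scale[OF scale, of c]
      by (simp add: hvar_scale scale_mult_right pm.scale_right_diff_distrib)
  next
    case (basis h)
    then show ?case using J_GG[OF g] g by (simp add: hvar_basis)
  qed
qed

lemma hvar_mult_var:
  assumes "s \<in> S"
  shows "hv h * var (Inl s) - sweedler (\<lambda>a b. emb (act a (f s)) * hv b) h \<in> J"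
proof (induction h rule: basis_induct)
  case (add g h)
  then show ?case
    using J.J_add[OF add]
    by (simp add: hvar_add sweedler_add[OF bilinear_emb_hvar] f_closed assms algebra_simps)
next
  case (scale c h)
  then show ?case
    using J.J_scale[OF scale, of c]
    by (simp add: hvar_scale sweedler_scale[OF bilinear_emb_hvar] f_closed assms
        pm.scale_right_diff_distrib)
next
  case (basis g)
  then show ?case using J_GS assms by (simp add: hvar_basis)
qed

lemma emb_act_mult:
  assumes "p \<in> free_carrier X" "q \<in> free_carrier X"
  shows "emb (act a (p * q)) = sweedler (\<lambda>c d. emb (act c p) * emb (act d q)) a"
  using sweedler_linear[OF linear_emb, of "\<lambda>c d. act c p * act d q" a] act_mult_right[OF assms]
  by (simp add: emb_mult)

text \<open>The induction on words keeps h arbitrary, since the hypothesis is applied to second legs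
  of \<Delta> h.\<close>

lemma hvar_mult_emb:
  assumes "p \<in> free_carrier X"
  shows "hv h * emb p - sweedler (\<lambda>a b. emb (act a p) * hv b) h \<in> J"
  using assms
proof (induction arbitrary: h rule: free_carrier_induct)
  case (add p q)
  have "sweedler (\<lambda>a b. emb (act a (p + q)) * hv b) h
      = sweedler (\<lambda>a b. emb (act a p) * hv b) h + sweedler (\<lambda>a b. emb (act a q) * hv b) h"
    by (simp add: act_add_right add emb_add distrib_right split_def flip: pm.lin_ext_fun_add)
  then show ?case
    using J.J_add[OF add(3,4)] by (simp add: emb_add algebra_simps)
next
  case (scale c p)
  have "sweedler (\<lambda>a b. emb (act a (psmult c p)) * hv b) h
      = psmult c (sweedler (\<lambda>a b. emb (act a p) * hv b) h)"
    by (simp add: act_scale_right scale emb_scale split_def flip: pm.lin_ext_fun_scale)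
  then show ?case
    using J.J_scale[OF scale(2), of c] by (simp add: emb_scale pm.scale_right_diff_distrib)
next
  case (word u)
  then show ?case
  proof (induction u arbitrary: h)
    case Nil
    \<comment> \<open>For the empty word the action on 1 is the counit, and the counit axiom returns
      h.\<close>
    have "sweedler (\<lambda>a b. emb (act a 1) * hv b) h = sweedler (\<lambda>a b. psmult (\<epsilon> a) (hv b)) h"
      by (simp add: act_one_right emb_scale)
    also have "\<dots> = hv h"
      by (rule sweedler_counit) (intro linear_psmult_targetI hvar_add hvar_scale)
    finally show ?case by (simp add: J.J_zero)
  next
    case (Cons x u)
    then have x: "x \<in> X" "x \<in> S" and u: "u \<in> lists X" using X_subset by auto
    let ?u = "Poly_Mapping.single u (1::'k)"
    have cl: "(var x :: 's list \<Rightarrow>\<^sub>0 'k) \<in> free_carrier X" "?u \<in> free_carrier X" using x u by auto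
    \<comment> \<open>The relation for g s at s = x applies with x itself in place of f x.\<close>
    have "hv h * var (Inl x) * emb ?u - sweedler (\<lambda>a b. emb (act a (var x)) * hv b) h * emb ?u \<in> J"
      using hvar_mult_var[OF x(2), of h] f_var[OF x(1)] cl
      by (intro J.J_mult) (auto simp: J.J_zero x simp del: emb_single)
    also have "sweedler (\<lambda>a b. emb (act a (var x)) * hv b) h * emb ?u
        = sweedler (\<lambda>a b. emb (act a (var x)) * (hv b * emb ?u)) h"
      by (simp add: lin_ext_mult split_def mult.assoc)
    finally have 1: "hv h * var (Inl x) * emb ?u
        - sweedler (\<lambda>a b. emb (act a (var x)) * (hv b * emb ?u)) h \<in> J" .
    \<comment> \<open>The second leg b now stands before the rest of the word, and the induction
      hypothesis moves it past.\<close>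
    have "sweedler (\<lambda>a b. emb (act a (var x)) * (hv b * emb ?u)) h
        - sweedler (\<lambda>a b. emb (act a (var x)) * sweedler (\<lambda>c d. emb (act c ?u) * hv d) b) h \<in> J"
      using Cons.IH cl
      by (intro J_sweedler J.J_mult) (auto simp: J.J_zero act_closed)
    also have "sweedler (\<lambda>a b. emb (act a (var x)) * sweedler (\<lambda>c d. emb (act c ?u) * hv d) b) h
        = sweedler (\<lambda>a b. sweedler (\<lambda>c d. emb (act a (var x)) * emb (act c ?u) * hv d) b) h"
      by (simp add: mult_lin_ext split_def mult.assoc)
    \<comment> \<open>Coassociativity splits the first leg instead of the second, so that the two
      actions fit the module algebra axiom for the product of x and u.\<close>
    also have "\<dots> = sweedler (\<lambda>a b. sweedler (\<lambda>c d. emb (act c (var x)) * emb (act d ?u) * hv b) a) h"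
      by (rule sweedler_coassoc[symmetric], rule trilinearI)
        (simp_all add: cl act_simps emb_add emb_scale hvar_add hvar_scale algebra_simps)
    also have "\<dots> = sweedler (\<lambda>a b. emb (act a (var x * ?u)) * hv b) h"
      unfolding emb_act_mult[OF cl] by (simp add: lin_ext_mult split_def)
    finally have "hv h * var (Inl x) * emb ?u - sweedler (\<lambda>a b. emb (act a (var x * ?u)) * hv b) h \<in> J"
      by (rule J.J_trans[OF 1])
    then show ?case
      unfolding single_Cons emb_mult emb_var mult.assoc .
  qed
qed

section \<open>Multiplicativity and surjectivity\<close>

abbreviation "smash_carrier \<equiv> {p :: 's list \<times> 'h \<Rightarrow>\<^sub>0 'k. Poly_Mapping.keys p \<subseteq> lists X \<times> G}"

lemma smash_carrier_subspace: "pm.subspace smash_carrier"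
proof (rule pm.subspaceI)
  fix p q :: "'s list \<times> 'h \<Rightarrow>\<^sub>0 'k" and c
  assume p: "p \<in> smash_carrier"
  then show "psmult c p \<in> smash_carrier"
    unfolding subset_iff mem_Collect_eq in_keys_iff lookup_psmult by (metis mult_not_zero)
  assume "q \<in> smash_carrier"
  with p show "p + q \<in> smash_carrier"
    using Poly_Mapping.keys_add[of p q] by blast
qed simp

lemma tens_closed: "p \<in> free_carrier X \<Longrightarrow> tensor p h \<in> smash_carrier"
  unfolding tens_def
  by (intro pm.lin_ext_in_subspace[OF smash_carrier_subspace])
    (use keys_coords[of h] in \<open>auto simp: free_carrier_def\<close>)

lemma smash_mult_closed:
  assumes "p \<in> smash_carrier" "q \<in> smash_carrier"
  shows "smash_mult scale \<Delta> act G p q \<in> smash_carrier"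
  unfolding smash_mult_def split_def
  using assms
  by (intro pm.lin_ext_in_subspace[OF smash_carrier_subspace] tens_closed
      free_carrier_mult act_closed single_in_free_carrier) auto

lemma incl_closed:
  assumes "p \<in> smash_carrier" shows "incl p \<in> free_carrier Y"
  unfolding incl_def split_def
  using assms X_subset
  by (intro pm.lin_ext_in_subspace[OF free_carrier_subspace] single_in_free_carrier) fastforce

text \<open>In the product of words u g v h, moving g past v and then merging its second leg with h
  yields exactly the smash product formula.\<close>

lemma incl_smash_mult:
  assumes "p \<in> smash_carrier" "q \<in> smash_carrier"
  shows "incl (smash_mult scale \<Delta> act G p q) - incl p * incl q \<in> J"
proof -
  let ?w = "\<lambda>u. Poly_Mapping.single u (1::'k)"
  have word: "sweedler (\<lambda>a b. emb (?w u * act a (?w v)) * hv (b * h)) g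
      - ?w (map Inl u) * var (Inr g) * (?w (map Inl v) * var (Inr h)) \<in> J"
    if u: "u \<in> lists X" and v: "v \<in> lists X" and g: "g \<in> G" and h: "h \<in> G" for u v g h
  proof -
    have wu: "?w u \<in> free_carrier X" and wv: "?w v \<in> free_carrier X" using u v by auto
    note cl = emb_closed[OF wu] emb_closed[OF act_closed[OF wv]]
    have "emb (?w u) * (hv g * emb (?w v) * hv h)
        - emb (?w u) * (sweedler (\<lambda>a b. emb (act a (?w v)) * hv b) g * hv h) \<in> J"
      using hvar_mult_emb[OF wv, of g] cl wv
      by (intro J.J_mult) (auto simp: J.J_zero simp del: emb_single intro!: free_carrier_mult)
    also have "emb (?w u) * (sweedler (\<lambda>a b. emb (act a (?w v)) * hv b) g * hv h)
        = sweedler (\<lambda>a b. emb (?w u) * emb (act a (?w v)) * (hv b * hv h)) g"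
      by (simp add: lin_ext_mult mult_lin_ext split_def mult.assoc)
    finally have 1: "emb (?w u) * (hv g * emb (?w v) * hv h)
        - sweedler (\<lambda>a b. emb (?w u) * emb (act a (?w v)) * (hv b * hv h)) g \<in> J" .
    have 2: "sweedler (\<lambda>a b. emb (?w u) * emb (act a (?w v)) * (hv b * hv h)) g
        - sweedler (\<lambda>a b. emb (?w u) * emb (act a (?w v)) * hv (b * h)) g \<in> J"
      using cl hvar_mult by (intro J_sweedler J.J_mult) (auto simp: J.J_zero)
    show ?thesis
      using J.J_sym[OF J.J_trans[OF 1 2]] g h
      by (simp only: emb_mult emb_single hvar_basis mult.assoc)
  qed
  have "incl p * incl q = lin_ext psmult (\<lambda>(u, g). lin_ext psmult (\<lambda>(v, h).
      ?w (map Inl u) * var (Inr g) * (?w (map Inl v) * var (Inr h))) q) p"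
    unfolding incl_def lin_ext_mult
    by (simp add: mult_lin_ext split_def var_def)
  moreover have "incl (smash_mult scale \<Delta> act G p q) = lin_ext psmult (\<lambda>(u, g).
      lin_ext psmult (\<lambda>(v, h). sweedler (\<lambda>a b. emb (?w u * act a (?w v)) * hv (b * h)) g) q) p"
    unfolding smash_mult_def
    by (simp add: linear_lin_ext_apply[OF linear_incl] split_def incl_tens)
  ultimately show ?thesis
    using assms by (auto intro!: J.J_lin_ext word)
qed

text \<open>Each letter is congruent to the image of some t. A word is then absorbed from right to
  left by multiplying in the smash product, whose product is known to be compatible with J.\<close>

lemma incl_surj: "a \<in> free_carrier Y \<Longrightarrow> \<exists>p\<in>smash_carrier. a - incl p \<in> J"
proof (induction rule: free_carrier_induct)
  case (add p q)
  then obtain x y where "x \<in> smash_carrier" "y \<in> smash_carrier" "p - incl x \<in> J" "q - incl y \<in> J"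
    by blast
  then show ?case
    using J.J_add[of "p - incl x" "q - incl y"] pm.subspace_add[OF smash_carrier_subspace]
    by (intro bexI[of _ "x + y"]) (simp_all add: linear_map_add[OF linear_incl] algebra_simps)
next
  case (scale c p)
  then obtain x where "x \<in> smash_carrier" "p - incl x \<in> J" by blast
  then show ?case
    using J.J_scale[of "p - incl x" c] pm.subspace_scale[OF smash_carrier_subspace]
    by (intro bexI[of _ "psmult c x"])
      (simp_all add: linear_map_scale[OF linear_incl] pm.scale_right_diff_distrib)
next
  case (word w)
  then show ?case
  proof (induction w)
    case Nil
    have "1 - incl (tensor 1 1) \<in> J"
      using J.J_sym[OF J_1] one_in_basis by (simp add: incl_tens hvar_basis)
    then show ?case using tens_closed[OF one_in_free_carrier] by auto
  next
    case (Cons y w)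
    then obtain p where p: "p \<in> smash_carrier" "Poly_Mapping.single w 1 - incl p \<in> J" by auto
    obtain t where t: "t \<in> smash_carrier" "var y - incl t \<in> J"
    proof (cases y)
      case (Inl s)
      then have s: "s \<in> S" using Cons by auto
      \<comment> \<open>The letter s corresponds to f s # 1. The factor 1 on the left is traded for
        the variable of the unit of H, since images of \<open>incl\<close> carry such a
        variable.\<close>
      have "var y * 1 - incl (tensor (f s) 1) \<in> J"
        using J_S[OF s] one_in_basis s Inl f_closed
        unfolding incl_tens by (intro J.J_mult) (auto simp: hvar_basis intro: J.J_sym[OF J_1])
      then show ?thesis using tens_closed[OF f_closed[OF s]] by (intro that[of "tensor (f s) 1"]) simp_all
    next
      case (Inr g)
      then have "g \<in> G" using Cons by auto
      then show ?thesis
        using that[of "Poly_Mapping.single ([], g) 1"] Inr by (simp add: incl_single J.J_zero)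
    qed
    have "var y * Poly_Mapping.single w 1 - incl t * incl p \<in> J"
      using Cons p t incl_closed by (intro J.J_mult) auto
    from J.J_trans[OF this J.J_sym[OF incl_smash_mult[OF t(1) p(1)]]] show ?case
      using smash_mult_closed[OF t(1) p(1)] by (auto simp: single_Cons)
  qed
qed

end

section \<open>The representation on the smash product\<close>

context smash_data
begin

definition opS :: "('s list \<Rightarrow>\<^sub>0 'k) \<Rightarrow> ('s list \<times> 'h \<Rightarrow>\<^sub>0 'k) \<Rightarrow> ('s list \<times> 'h \<Rightarrow>\<^sub>0 'k)" where
  "opS q = lin_ext psmult (\<lambda>(v, h). tensor (q * Poly_Mapping.single v 1) h)"

text \<open>The operator of left multiplication by 1 # g, for arbitrary g in H.\<close>

definition opH :: "'h \<Rightarrow> ('s list \<times> 'h \<Rightarrow>\<^sub>0 'k) \<Rightarrow> ('s list \<times> 'h \<Rightarrow>\<^sub>0 'k)" where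
  "opH g = lin_ext psmult
     (\<lambda>(v, h). sweedler (\<lambda>a b. tensor (act a (Poly_Mapping.single v 1)) (b * h)) g)"

text \<open>With \<open>foldr\<close> the leftmost letter acts last, so concatenation becomes
  composition in the same order.\<close>

definition op_word :: "('s + 'h) list \<Rightarrow> ('s list \<times> 'h \<Rightarrow>\<^sub>0 'k) \<Rightarrow> ('s list \<times> 'h \<Rightarrow>\<^sub>0 'k)" where
  "op_word = foldr (case_sum (\<lambda>s. opS (f s)) opH)"

definition op :: "(('s + 'h) list \<Rightarrow>\<^sub>0 'k) \<Rightarrow> ('s list \<times> 'h \<Rightarrow>\<^sub>0 'k) \<Rightarrow> ('s list \<times> 'h \<Rightarrow>\<^sub>0 'k)" where
  "op a x = lin_ext psmult (\<lambda>w. op_word w x) a"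

lemma op_word_simps:
  "op_word [] x = x" "op_word (Inl s # w) x = opS (f s) (op_word w x)"
  "op_word (Inr g # w) x = opH g (op_word w x)" "op_word (w @ w') x = op_word w (op_word w' x)"
  by (simp_all add: op_word_def)

lemma linear_op_word: "Vector_Spaces.linear psmult psmult (op_word w)"
proof (induction w)
  case Nil
  show ?case by (rule linear_psmultI) (simp_all add: op_word_simps)
next
  case (Cons y w)
  show ?case
    by (rule linear_psmultI; cases y)
      (simp_all add: op_word_simps linear_map_add[OF Cons] linear_map_scale[OF Cons]
        opS_def opH_def pm.lin_ext_add pm.lin_ext_psmult)
qed

lemma linear_op_left: "Vector_Spaces.linear psmult psmult (\<lambda>a. op a x)"
  unfolding op_def by (rule pm.linear_lin_ext)

lemma linear_op: "Vector_Spaces.linear psmult psmult (op a)"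
  by (rule linear_psmultI)
    (simp_all add: op_def linear_map_add[OF linear_op_word] linear_map_scale[OF linear_op_word]
      pm.lin_ext_fun_add pm.lin_ext_fun_scale)

lemma op_add: "op (a + b) x = op a x + op b x"
  and op_scale: "op (psmult c a) x = psmult c (op a x)"
  and op_diff: "op (a - b) x = op a x - op b x"
  by (simp_all add: op_def pm.lin_ext_add pm.lin_ext_psmult pm.lin_ext_diff)

lemma op_single [simp]: "op (Poly_Mapping.single w 1) x = op_word w x"
  by (simp add: op_def)

lemma op_one [simp]: "op 1 x = x"
  unfolding single_Nil_1[symmetric] op_single op_word_simps ..

lemma op_zero [simp]: "op 0 x = 0"
  by (simp add: op_def)

lemma op_var_Inl: "op (var (Inl s)) x = opS (f s) x"
  by (simp add: var_def op_word_simps)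

lemma op_mult: "op (a * b) x = op a (op b x)"
proof -
  have w: "op (Poly_Mapping.single w 1 * b) x = op_word w (op b x)" for w
    using linear_lin_ext_apply[OF linear_op_left[of x], of "\<lambda>v. Poly_Mapping.single (w @ v) 1" b]
      mult_lin_ext[of "Poly_Mapping.single w 1" "\<lambda>v. Poly_Mapping.single v 1" b]
      linear_lin_ext_apply[OF linear_op_word, of w "\<lambda>v. op_word v x" b]
    by (simp add: op_word_simps op_def)
  have "op (lin_ext psmult (\<lambda>w. Poly_Mapping.single w 1 * b) a) x = op a (op b x)"
    by (simp add: linear_lin_ext_apply[OF linear_op_left] w op_def[of a "op b x"])
  then show ?thesis by (simp flip: lin_ext_mult)
qed

section \<open>The operators on pure tensors\<close>

lemma opS_tens: "opS q (tensor p h) = tensor (q * p) h"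
proof (induction h rule: basis_induct)
  case (basis h)
  have "opS q (tensor p h) = opS q (lin_ext psmult (\<lambda>u. Poly_Mapping.single (u, h) 1) p)"
    by (simp add: tens_def coords_basis basis)
  also have "\<dots> = lin_ext psmult (\<lambda>u. tensor (q * Poly_Mapping.single u 1) h) p"
    by (simp add: opS_def pm.lin_ext_lin_ext)
  also have "\<dots> = tensor (lin_ext psmult (\<lambda>u. q * Poly_Mapping.single u 1) p) h"
    by (rule linear_lin_ext_apply[symmetric], rule linear_psmultI)
      (simp_all add: tens_add_left tens_scale_left)
  finally show ?case by (simp flip: mult_lin_ext)
qed (simp_all add: opS_def tens_add_right tens_scale_right pm.lin_ext_add pm.lin_ext_psmult)

text \<open>Linearity of the action is available only on k<X>, hence the restriction on p, which
  \<open>opS_tens\<close> does without. Linearity in p and in h reduces the claim to the defining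
  case.\<close>

lemma opH_tens:
  assumes "p \<in> free_carrier X"
  shows "opH g (tensor p h) = sweedler (\<lambda>a b. tensor (act a p) (b * h)) g"
  using assms
proof (induction rule: free_carrier_induct)
  case (add p q)
  then show ?case
    by (simp add: tens_add_left act_add_right split_def pm.lin_ext_fun_add)
      (simp add: opH_def pm.lin_ext_add split_def)
next
  case (scale c p)
  then show ?case
    by (simp add: tens_scale_left act_scale_right split_def pm.lin_ext_fun_scale)
      (simp add: opH_def pm.lin_ext_psmult split_def)
next
  case (word u)
  show ?case
  proof (induction h rule: basis_induct)
    case (add h h')
    then show ?case
      by (simp add: tens_add_right distrib_left split_def pm.lin_ext_fun_add)
        (simp add: opH_def pm.lin_ext_add split_def)
  next
    case (scale c h)
    then show ?case
      by (simp add: tens_scale_right scale_mult_right split_def pm.lin_ext_fun_scale)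
        (simp add: opH_def pm.lin_ext_psmult split_def)
  next
    case (basis g)
    then show ?case by (simp add: tens_basis opH_def)
  qed
qed

text \<open>A letter x of X acts by multiplication with f x, which is x; words and then linear
  combinations follow.\<close>

lemma op_emb:
  assumes "q \<in> free_carrier X"
  shows "op (emb q) (tensor p h) = tensor (q * p) h"
  using assms
proof (induction rule: free_carrier_induct)
  case (word u)
  then show ?case
  proof (induction u)
    case (Cons x u)
    then show ?case
      by (simp add: single_Cons emb_mult op_mult emb_var op_var_Inl opS_tens f_var mult.assoc)
  qed (simp add: op_word_simps)
qed (simp_all add: emb_add emb_scale op_add op_scale tens_add_left tens_scale_left distrib_right)

lemma op_hvar:
  assumes "p \<in> free_carrier X"
  shows "op (hv g) (tensor p h) = sweedler (\<lambda>a b. tensor (act a p) (b * h)) g"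
proof (induction g rule: basis_induct)
  case (basis g)
  then show ?case by (simp add: hvar_basis var_def op_word_simps opH_tens assms)
qed (simp_all add: hvar_add hvar_scale op_add op_scale
    sweedler_add[OF bilinear_tens] sweedler_scale[OF bilinear_tens] assms)

text \<open>The submodule on which the relations can be verified. Describing it as a span reduces
  every linear identity on it to pure tensors with first factor in k<X>.\<close>

definition tens_span :: "('s list \<times> 'h \<Rightarrow>\<^sub>0 'k) set" where
  "tens_span = pm.span {tensor p h | p h. p \<in> free_carrier X}"

lemma tens_span_subspace: "pm.subspace tens_span"
  unfolding tens_span_def by (rule pm.subspace_span)

lemma tens_in_span [intro]: "p \<in> free_carrier X \<Longrightarrow> tensor p h \<in> tens_span"
  unfolding tens_span_def by (rule pm.span_base) blast

lemma tens_span_subset: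
  "pm.subspace W \<Longrightarrow> (\<And>p h. p \<in> free_carrier X \<Longrightarrow> tensor p h \<in> W) \<Longrightarrow> tens_span \<subseteq> W"
  unfolding tens_span_def by (rule pm.span_minimal) blast+

lemma op_word_tens_span: "w \<in> lists Y \<Longrightarrow> x \<in> tens_span \<Longrightarrow> op_word w x \<in> tens_span"
proof (induction w)
  case (Cons y w)
  have "op_word [y] (tensor p h) \<in> tens_span" if p: "p \<in> free_carrier X" for p h
  proof (cases y)
    case (Inl s)
    then have "f s \<in> free_carrier X" using Cons f_closed by auto
    then show ?thesis using Inl p by (auto simp: op_word_simps opS_tens)
  next
    case (Inr g)
    then show ?thesis using p
      by (auto simp: op_word_simps opH_tens intro!: pm.lin_ext_in_subspace[OF tens_span_subspace] act_closed)
  qed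
  then have "tens_span \<subseteq> {x. op_word [y] x \<in> tens_span}"
    by (intro tens_span_subset linear_subspace_vimage[OF linear_op_word tens_span_subspace]) auto
  then show ?case using Cons op_word_simps(4)[of "[y]" w x] by auto
qed (simp add: op_word_simps)

lemma op_tens_span: "a \<in> free_carrier Y \<Longrightarrow> x \<in> tens_span \<Longrightarrow> op a x \<in> tens_span"
  unfolding op_def
  by (rule pm.lin_ext_in_subspace[OF tens_span_subspace], rule op_word_tens_span)
    (auto simp: free_carrier_def)

definition ann :: "(('s + 'h) list \<Rightarrow>\<^sub>0 'k) set" where
  "ann = {a \<in> free_carrier Y. \<forall>x\<in>tens_span. op a x = 0}"

lemma annI:
  assumes "a \<in> free_carrier Y" "\<And>p h. p \<in> free_carrier X \<Longrightarrow> op a (tensor p h) = 0"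
  shows "a \<in> ann"
proof -
  have "tens_span \<subseteq> {x. op a x \<in> {0}}"
    by (intro tens_span_subset linear_subspace_vimage[OF linear_op] pm.subspace_single_0)
      (simp add: assms)
  then show ?thesis using assms(1) by (auto simp: ann_def)
qed

text \<open>Left multiples annihilate trivially; for right multiples the stability of
  \<open>tens_span\<close> under the operators is essential.\<close>

lemma ideal_ann: "ideal ann (free_alg Y)"
proof (rule ideal_free_algI)
  show "pm.subspace ann"
    by (rule pm.subspaceI) (auto simp: ann_def op_add op_scale)
  show "x * a \<in> ann" if "a \<in> ann" "x \<in> free_carrier Y" for a x
    \<comment> \<open>Scaling by 0 gives that the operator of x maps 0 to 0.\<close>
    using that linear_map_scale[OF linear_op, of x 0 0] by (auto simp: ann_def op_mult)
  show "a * x \<in> ann" if "a \<in> ann" "x \<in> free_carrier Y" for a x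
    using that op_tens_span by (auto simp: ann_def op_mult)
qed (auto simp: ann_def)

section \<open>The defining relations act as zero\<close>

lemma gens_S_ann: "gens_S \<subseteq> ann"
proof
  fix a assume a: "a \<in> gens_S"
  then obtain s where s: "s \<in> S" "a = var (Inl s) - emb (f s)" by (auto simp: gens_S_def)
  show "a \<in> ann"
    using a gens_closed s
    by (intro annI) (auto simp: op_diff var_def op_word_simps opS_tens op_emb f_closed)
qed

lemma op_var_Inr:
  "p \<in> free_carrier X \<Longrightarrow> op (var (Inr g)) (tensor p h) = sweedler (\<lambda>a b. tensor (act a p) (b * h)) g"
  by (simp add: var_def op_word_simps opH_tens)

lemma op_sweedler: "op (sweedler \<phi> g) x = sweedler (\<lambda>a b. op (\<phi> a b) x) g"
  by (rule sweedler_linear[OF linear_op_left])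

text \<open>Operator counterpart of the straightening rule: coassociativity regroups the legs so
  that the module algebra axiom combines the actions on f s and p.\<close>

lemma gen_GS_ann:
  assumes s: "s \<in> S" and p: "p \<in> free_carrier X"
  shows "op (var (Inr g) * var (Inl s)) (tensor p h)
    = op (sweedler (\<lambda>a b. emb (act a (f s)) * hv b) g) (tensor p h)"
proof -
  note f = f_closed[OF s]
  have "op (sweedler (\<lambda>a b. emb (act a (f s)) * hv b) g) (tensor p h)
      = sweedler (\<lambda>a b. op (emb (act a (f s))) (sweedler (\<lambda>c d. tensor (act c p) (d * h)) b)) g"
    by (simp add: op_sweedler op_mult op_hvar p)
  also have "\<dots> = sweedler (\<lambda>a b. sweedler (\<lambda>c d. tensor (act a (f s) * act c p) (d * h)) b) g"
    by (simp add: sweedler_linear[OF linear_op] op_emb act_closed f)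
  also have "\<dots> = sweedler (\<lambda>a b. sweedler (\<lambda>c d. tensor (act c (f s) * act d p) (b * h)) a) g"
    by (rule sweedler_coassoc[symmetric], rule trilinearI)
      (simp_all add: f p act_simps tens_add_left tens_add_right tens_scale_left tens_scale_right
        scale_mult_left algebra_simps)
  also have "\<dots> = sweedler (\<lambda>a b. tensor (act a (f s * p)) (b * h)) g"
  proof -
    have "Vector_Spaces.linear psmult psmult (\<lambda>q. tensor q k)" for k
      by (rule linear_psmultI) (simp_all add: tens_add_left tens_scale_left)
    note tens_sweedler = sweedler_linear[OF this]
    show ?thesis
      by (simp only: act_mult_right[OF f p] tens_sweedler)
  qed
  also have "\<dots> = op (var (Inr g) * var (Inl s)) (tensor p h)"
    using f p by (simp add: op_mult op_var_Inr free_carrier_mult)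
      (simp add: var_def op_word_simps opS_tens opH_tens free_carrier_mult)
  finally show ?thesis by simp
qed

text \<open>After interchanging the two sums this is multiplicativity of \<Delta> together with the
  action of a product being the composite action.\<close>

lemma gen_GG_ann:
  assumes p: "p \<in> free_carrier X"
  shows "op (var (Inr g) * var (Inr h)) (tensor p k) = op (hv (g * h)) (tensor p k)"
proof -
  have "op (var (Inr g) * var (Inr h)) (tensor p k)
      = sweedler (\<lambda>c d. sweedler (\<lambda>a b. tensor (act a (act c p)) (b * (d * k))) g) h"
    by (simp add: op_mult op_var_Inr p sweedler_linear[OF linear_op] act_closed)
  also have "\<dots> = sweedler (\<lambda>a b. sweedler (\<lambda>c d. tensor (act (a * c) p) ((b * d) * k)) h) g"
    unfolding split_def
    by (subst lin_ext_swap) (simp add: act_mult_left p mult.assoc)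
  also have "\<dots> = op (hv (g * h)) (tensor p k)"
    by (simp add: op_hvar p sweedler_mult[OF bilinear_tens[OF p]])
  finally show ?thesis .
qed

lemma gens_G_ann: "gens_G \<subseteq> ann"
proof
  fix a assume a: "a \<in> gens_G"
  then have cl: "a \<in> free_carrier Y" using gens_closed by auto
  have "op a (tensor p h) = 0" if p: "p \<in> free_carrier X" for p h
    using a unfolding gens_G_def
  proof (elim UnE CollectE exE conjE)
    \<comment> \<open>Since \<Delta> 1 is equivalent to 1 tensor 1 and 1 acts as the identity, the
      variable of the unit fixes p # h.\<close>
    assume "a \<in> {var (Inr 1) - 1}"
    then show ?thesis
      using op_var_Inr[OF p, of 1 h] sweedler_one[OF bilinear_tens[OF p], of h]
      by (simp add: op_diff op_one act_one_left p)
  qed (simp_all add: op_diff gen_GS_ann gen_GG_ann p)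
  then show "a \<in> ann" by (intro annI cl)
qed

lemma J_ann: "J \<subseteq> ann"
proof -
  interpret N: free_ideal ann Y by (rule free_ideal.intro[OF ideal_ann])
  have "I_S S G f \<subseteq> ann" "I_G scale \<Delta> act S G f \<subseteq> ann"
    unfolding I_S_eq I_G_eq
    by (intro F.genideal_minimal ideal_ann gens_S_ann gens_G_ann)+
  then show ?thesis
    by (auto simp: set_add_def' free_SG_def intro: N.J_add)
qed

text \<open>Evaluation at 1 # 1 is a left inverse of \<open>incl\<close> on the carrier of the smash
  product.\<close>

lemma op_incl_one:
  assumes "x \<in> smash_carrier"
  shows "op (incl x) (tensor 1 1) = x"
proof -
  have word: "op (Poly_Mapping.single (map Inl u @ [Inr g]) 1) (tensor 1 1)
      = Poly_Mapping.single (u, g) 1" if u: "u \<in> lists X" and g: "g \<in> G" for u g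
  proof -
    have "op (Poly_Mapping.single (map Inl u @ [Inr g]) 1) (tensor 1 1)
        = op (emb (Poly_Mapping.single u 1)) (op (var (Inr g)) (tensor 1 1))"
      by (simp add: op_word_simps var_def)
    \<comment> \<open>Acting on 1 produces the counit of the first leg, and the counit axiom leaves
      1 # g.\<close>
    also have "op (var (Inr g)) (tensor 1 1) = sweedler (\<lambda>a b. psmult (\<epsilon> a) (tensor 1 b)) g"
      by (simp add: op_var_Inr act_one_right tens_scale_left)
    also have "\<dots> = tensor 1 g"
      by (rule sweedler_counit) (intro linear_psmult_targetI tens_add_right tens_scale_right)
    also have "op (emb (Poly_Mapping.single u 1)) (tensor 1 g) = Poly_Mapping.single (u, g) 1"
      using u g by (subst op_emb) (auto simp: tens_basis)
    finally show ?thesis .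
  qed
  have "op (incl x) (tensor 1 1) = lin_ext psmult
      (\<lambda>(u, g). op (Poly_Mapping.single (map Inl u @ [Inr g]) 1) (tensor 1 1)) x"
    unfolding incl_def by (simp add: linear_lin_ext_apply[OF linear_op_left] split_def)
  also have "\<dots> = lin_ext psmult (\<lambda>y. Poly_Mapping.single y 1) x"
    by (rule lin_ext_cong) (use assms word in \<open>fastforce simp del: op_single\<close>)
  finally show ?thesis by simp
qed

lemma incl_inj:
  assumes "x \<in> smash_carrier" "y \<in> smash_carrier" "incl x - incl y \<in> J"
  shows "x = y"
proof -
  have "op (incl x - incl y) (tensor 1 1) = 0"
    using assms(3) J_ann tens_in_span[OF one_in_free_carrier] by (auto simp: ann_def)
  then show ?thesis
    using op_incl_one[OF assms(1)] op_incl_one[OF assms(2)] by (simp add: op_diff)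
qed

theorem presentation_smash: "presentation J Y (smash scale \<Delta> act G X) incl"
proof unfold_locales
  show "incl \<one>\<^bsub>smash scale \<Delta> act G X\<^esub> - 1 \<in> J"
    using J_1 one_in_basis by (simp add: smash_def incl_tens hvar_basis)
  show "\<one>\<^bsub>smash scale \<Delta> act G X\<^esub> \<in> carrier (smash scale \<Delta> act G X)"
    using tens_closed[OF one_in_free_carrier] by (simp add: smash_def)
  fix a :: "('s + 'h) list \<Rightarrow>\<^sub>0 'k" assume "a \<in> free_carrier Y"
  then show "\<exists>x\<in>carrier (smash scale \<Delta> act G X). a - incl x \<in> J"
    using incl_surj by (simp add: smash_def)
next
  fix x y assume xy: "x \<in> carrier (smash scale \<Delta> act G X)" "y \<in> carrier (smash scale \<Delta> act G X)"
  then have xy': "x \<in> smash_carrier" "y \<in> smash_carrier" by (simp_all add: smash_def)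
  show "incl (x \<otimes>\<^bsub>smash scale \<Delta> act G X\<^esub> y) - incl x * incl y \<in> J"
    using incl_smash_mult[OF xy'] by (simp add: smash_def)
  show "x \<otimes>\<^bsub>smash scale \<Delta> act G X\<^esub> y \<in> carrier (smash scale \<Delta> act G X)"
    using smash_mult_closed[OF xy'] by (simp add: smash_def)
  show "incl (x \<oplus>\<^bsub>smash scale \<Delta> act G X\<^esub> y) = incl x + incl y"
    by (simp add: smash_def linear_map_add[OF linear_incl])
  show "incl x - incl y \<in> J \<Longrightarrow> x = y" by (rule incl_inj[OF xy'])
next
  fix x c assume x: "x \<in> carrier (smash scale \<Delta> act G X)"
  then have x': "x \<in> smash_carrier" by (simp add: smash_def)
  show "incl x \<in> free_carrier Y" by (rule incl_closed[OF x'])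
  show "c \<odot>\<^bsub>smash scale \<Delta> act G X\<^esub> x \<in> carrier (smash scale \<Delta> act G X)"
    using pm.subspace_scale[OF smash_carrier_subspace x'] by (simp add: smash_def)
  show "incl (c \<odot>\<^bsub>smash scale \<Delta> act G X\<^esub> x) = psmult c (incl x)"
    by (simp add: smash_def linear_map_scale[OF linear_incl])
qed

end

theorem proposition5p5:
  fixes X S :: "'s set"
    and scale :: "'k::field \<Rightarrow> 'h::ring_1 \<Rightarrow> 'h"
    and \<Delta> :: "'h \<Rightarrow> ('h \<times> 'h \<Rightarrow>\<^sub>0 'k)"
    and \<epsilon> :: "'h \<Rightarrow> 'k"
    and G :: "'h set"
    and act :: "'h \<Rightarrow> ('s list \<Rightarrow>\<^sub>0 'k) \<Rightarrow> ('s list \<Rightarrow>\<^sub>0 'k)"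
    and f :: "'s \<Rightarrow> ('s list \<Rightarrow>\<^sub>0 'k)"
  assumes "X \<subseteq> S"
    and "bialgebra scale \<Delta> \<epsilon>"
    and "is_basis scale G"
    and "1 \<in> G"
    and "module_algebra scale \<Delta> \<epsilon> psmult (free_carrier X) act"
    and "\<forall>s\<in>S. f s \<in> free_carrier X"
    and "\<forall>x\<in>X. f x = var x"
  shows
    "alg_iso (smash scale \<Delta> act G X)
       (alg_quot (free_SG S G) (I_S S G f <+>\<^bsub>free_SG S G\<^esub> I_G scale \<Delta> act S G f)) \<and>
     (\<forall>I. ideal I (smash scale \<Delta> act G X) \<longrightarrow>
       ideal (I_S S G f <+>\<^bsub>free_SG S G\<^esub> I_G scale \<Delta> act S G f <+>\<^bsub>free_SG S G\<^esub> incl ` I) (free_SG S G) \<and>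
       alg_iso (alg_quot (smash scale \<Delta> act G X) I)
         (alg_quot (free_SG S G)
           (I_S S G f <+>\<^bsub>free_SG S G\<^esub> I_G scale \<Delta> act S G f <+>\<^bsub>free_SG S G\<^esub> incl ` I))) \<and>
     (alg_iso (type_alg scale) (type_alg ((*) :: 'k \<Rightarrow> 'k \<Rightarrow> 'k)) \<longrightarrow>
       alg_iso (free_alg X) (alg_quot (free_alg S) (I_S_plain S f)) \<and>
       (\<forall>I. ideal I (free_alg X) \<longrightarrow>
         ideal (I_S_plain S f <+>\<^bsub>free_alg S\<^esub> I) (free_alg S) \<and>
         alg_iso (alg_quot (free_alg X) I) (alg_quot (free_alg S) (I_S_plain S f <+>\<^bsub>free_alg S\<^esub> I)))) \<and>
     (S = X \<longrightarrow>
       alg_iso (smash scale \<Delta> act G X) (alg_quot (free_SG X G) (I_G scale \<Delta> act X G f)) \<and>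
       (\<forall>I. ideal I (smash scale \<Delta> act G X) \<longrightarrow>
         ideal (I_G scale \<Delta> act X G f <+>\<^bsub>free_SG X G\<^esub> incl ` I) (free_SG X G) \<and>
         alg_iso (alg_quot (smash scale \<Delta> act G X) I)
           (alg_quot (free_SG X G) (I_G scale \<Delta> act X G f <+>\<^bsub>free_SG X G\<^esub> incl ` I))))"
proof -
  interpret bialgebra scale \<Delta> \<epsilon> by fact
  interpret module_algebra scale \<Delta> \<epsilon> psmult "free_carrier X" act by fact
  interpret smash_data scale \<Delta> \<epsilon> X act G S f
    by unfold_locales (use assms in auto)
  interpret P: presentation J Y "smash scale \<Delta> act G X" incl by (rule presentation_smash)
  \<comment> \<open>The special case of trivial H lives in k<S>, so it is read off from the
    presentation by S alone.\<close>
  interpret Q: presentation "I_S_plain S f" S "free_alg X" "\<lambda>p. p"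
    by (rule presentation_plain) (use assms in auto)
  have smash: "alg_iso (smash scale \<Delta> act G X) (alg_quot (free_SG S G) J)"
    unfolding free_SG_def using P.iso_quotient unfolding free_SG_def .
  have smash_quot: "ideal (J <+>\<^bsub>free_SG S G\<^esub> incl ` I) (free_SG S G)"
      "alg_iso (alg_quot (smash scale \<Delta> act G X) I)
        (alg_quot (free_SG S G) (J <+>\<^bsub>free_SG S G\<^esub> incl ` I))"
    if "ideal I (smash scale \<Delta> act G X)" for I
    using P.sum_ideal[OF that] P.iso_quotient_sum[OF that] unfolding free_SG_def by auto
  have plain_quot: "ideal (I_S_plain S f <+>\<^bsub>free_alg S\<^esub> I) (free_alg S)"
      "alg_iso (alg_quot (free_alg X) I) (alg_quot (free_alg S) (I_S_plain S f <+>\<^bsub>free_alg S\<^esub> I))"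
    if "ideal I (free_alg X)" for I
    using Q.sum_ideal[OF that] Q.iso_quotient_sum[OF that] by simp_all
  have J_eq: "J = I_G scale \<Delta> act X G f" if SX: "S = X"
  proof -
    \<comment> \<open>With S = X each generator is x - f x = 0, so I_S vanishes and only I_G
      remains.\<close>
    have "gens_S \<subseteq> {0}"
      unfolding gens_S_def using assms(7) SX by (auto simp: var_def)
    then have "I_S S G f = {0}"
      using F.genideal_minimal[OF F.zeroideal, of gens_S]
        additive_subgroup.zero_closed[OF ideal.axioms(1)[OF ideal_I_S]]
      by (auto simp: I_S_eq)
    then show ?thesis
      using SX by (simp add: set_add_def' free_SG_def)
  qed
  have S_eq_X: "alg_iso (smash scale \<Delta> act G X) (alg_quot (free_SG X G) (I_G scale \<Delta> act X G f)) \<and>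
       (\<forall>I. ideal I (smash scale \<Delta> act G X) \<longrightarrow>
         ideal (I_G scale \<Delta> act X G f <+>\<^bsub>free_SG X G\<^esub> incl ` I) (free_SG X G) \<and>
         alg_iso (alg_quot (smash scale \<Delta> act G X) I)
           (alg_quot (free_SG X G) (I_G scale \<Delta> act X G f <+>\<^bsub>free_SG X G\<^esub> incl ` I)))"
    if "S = X"
    using smash smash_quot unfolding J_eq[OF that] unfolding that by (intro conjI allI impI)
  show ?thesis
    by (intro conjI allI impI smash smash_quot Q.iso_quotient plain_quot S_eq_X)
qed

end
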